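(* There exist foliations $\mathcal F\in T_1$ that are not holomorphically equivalent to any foliation in $T_1$ defined by a polynomial equation, i.e. for which there is no germ of biholomorphism $\Phi:(\mathbb C^2,0)\to(\mathbb C^2,0)$ taking $\mathcal F$ to a foliation of $T_1$ defined by a $1$-form $P(x,y)\,dx+Q(x,y)\,dy$ with $P,Q\in\mathbb C[x,y]$.
   Context: $T_1$ denotes the set of germs at $0\in\mathbb C^2$ of holomorphic foliations defined by a $1$-form $\sum_{j\ge2}b_j(x,y)\,dx-\sum_{j\ge2}a_j(x,y)\,dy=0$, where $a_j,b_j$ are homogeneous polynomials of degree $j$ (the series converging near $0$), $a_2(x,y)=xy$, $b_2(x,y)=y^2$, and $x\,b_3(x,y)-y\,a_3(x,y)=\beta x^4$ for some $\beta\neq0$. After one blow-up $(x,t)\mapsto(x,tx)$ such a foliation becomes regular near the exceptional divisor, with exactly one tangency point with the divisor, of order $1$, located at $t=0$. Two germs of foliations are holomorphically equivalent if they are conjugated by a germ of holomorphic diffeomorphism of $(\mathbb C^2,0)$. *)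

theory Defs
  imports "HOL-Analysis.Analysis"
begin

text \<open>Germs of holomorphic functions at 0 in C^2 are represented by coefficient
arrays c (m,n) of convergent double power series  sum c(m,n) x^m y^n.\<close>

definition conv_ps :: "(nat \<times> nat \<Rightarrow> complex) \<Rightarrow> bool" where
  "conv_ps c \<longleftrightarrow> (\<exists>r>0. (\<lambda>(m,n). norm (c (m,n)) * r ^ (m+n)) summable_on UNIV)"

definition ps_eval :: "(nat \<times> nat \<Rightarrow> complex) \<Rightarrow> complex \<times> complex \<Rightarrow> complex" where
  "ps_eval c p = (\<Sum>\<^sub>\<infinity>(m,n)\<in>UNIV. c (m,n) * fst p ^ m * snd p ^ n)"

definition hom_part :: "(nat \<times> nat \<Rightarrow> complex) \<Rightarrow> nat \<Rightarrow> complex \<times> complex \<Rightarrow> complex" where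
  "hom_part c j p = (\<Sum>m\<le>j. c (m, j - m) * fst p ^ m * snd p ^ (j - m))"

text \<open>The foliation given by  B dx - A dy = 0  with A = ps_eval a, B = ps_eval b
belongs to T_1.\<close>
definition in_T1 :: "(nat \<times> nat \<Rightarrow> complex) \<Rightarrow> (nat \<times> nat \<Rightarrow> complex) \<Rightarrow> bool" where
  "in_T1 a b \<longleftrightarrow> conv_ps a \<and> conv_ps b \<and>
     (\<forall>j<2. hom_part a j = (\<lambda>_. 0) \<and> hom_part b j = (\<lambda>_. 0)) \<and>
     hom_part a 2 = (\<lambda>p. fst p * snd p) \<and>
     hom_part b 2 = (\<lambda>p. snd p ^ 2) \<and>
     (\<exists>\<beta>::complex. \<beta> \<noteq> 0 \<and>
        (\<forall>x y. x * hom_part b 3 (x,y) - y * hom_part a 3 (x,y) = \<beta> * x ^ 4))"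

definition holo_germ :: "(complex \<times> complex \<Rightarrow> complex) \<Rightarrow> bool" where
  "holo_germ f \<longleftrightarrow> (\<exists>c. conv_ps c \<and> (\<forall>\<^sub>F p in nhds 0. f p = ps_eval c p))"

definition biholo_germ :: "(complex \<times> complex \<Rightarrow> complex \<times> complex) \<Rightarrow> bool" where
  "biholo_germ \<Phi> \<longleftrightarrow> holo_germ (\<lambda>p. fst (\<Phi> p)) \<and> holo_germ (\<lambda>p. snd (\<Phi> p)) \<and> \<Phi> 0 = 0 \<and>
     (\<exists>\<Psi>. holo_germ (\<lambda>p. fst (\<Psi> p)) \<and> holo_germ (\<lambda>p. snd (\<Psi> p)) \<and> \<Psi> 0 = 0 \<and>
        (\<forall>\<^sub>F p in nhds 0. \<Psi> (\<Phi> p) = p \<and> \<Phi> (\<Psi> p) = p))"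

text \<open>Phi takes the foliation of  B dx - A dy  (tangent to the field A d/dx + B d/dy)
to the foliation of  B' dx - A' dy: the pull-back form Phi^* (B' dx - A' dy)
annihilates the field (A,B) near 0, i.e. the two forms have zero wedge product.\<close>
definition hol_equiv :: "(nat \<times> nat \<Rightarrow> complex) \<Rightarrow> (nat \<times> nat \<Rightarrow> complex) \<Rightarrow>
    (nat \<times> nat \<Rightarrow> complex) \<Rightarrow> (nat \<times> nat \<Rightarrow> complex) \<Rightarrow> bool" where
  "hol_equiv a b a' b' \<longleftrightarrow> (\<exists>\<Phi>. biholo_germ \<Phi> \<and>
     (\<forall>\<^sub>F p in nhds 0. \<exists>L. (\<Phi> has_derivative L) (at p) \<and>
        ps_eval b' (\<Phi> p) * fst (L (ps_eval a p, ps_eval b p))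
        - ps_eval a' (\<Phi> p) * snd (L (ps_eval a p, ps_eval b p)) = 0))"

end

theory Submission
  imports Defs
begin

text \<open>
  Consider the foliation of the field \<open>A \<partial>\<^sub>x + B \<partial>\<^sub>y\<close> with \<open>A = x y + x\<^sup>2 f(x)\<close> and
  \<open>B = y\<^sup>2 + x y f(x) + x\<^sup>3\<close>; after the blow-up \<open>y = t x\<close> it is
  \<open>dx/dt = t + f(x)\<close>. If it is conjugated to a polynomial foliation of the same class, then the
  formal first integrals of the latter, pulled back, are first integrals \<open>K(x,t)\<close> of
  \<open>dx/dt = t + f(x)\<close>. On the divisor the conjugacy is a Moebius map, so the coefficients of
  \<open>K(0,t)\<close> up to order \<open>N\<close> lie in \<open>R[1/N!]\<close> for a fixed finitely generated ring \<open>R\<close>,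
  generated by the coefficients of the polynomials and of the linear part of the conjugacy. The
  restriction of \<open>K\<close> to the divisor determines \<open>f\<close> triangularly, and thus
  \<open>f\<^sub>j\<close> is in \<open>R[1/(2j+1)!]\<close> for all \<open>j\<close>. Taking \<open>f\<^sub>j = 1/p\<^sub>j\<close>
  with a prime \<open>p\<^sub>j > 2j+1\<close>, infinitely many primes would be invertible in \<open>R\<close>, which is
  impossible in a finitely generated domain of characteristic zero.
\<close>

unbundle no vec_syntax
unbundle fps_syntax

section \<open>Primes inverted in finitely generated rings\<close>

text \<open>The obstacle is that a conjugacy has infinitely many Taylor coefficients, none of them
  under control. They are kept out of sight: with \<open>X\<close> and \<open>T\<close> the
  coordinates pulled back by the blown-up conjugacy, a first integral is built as a polynomial in
  \<open>X\<close> and \<open>T\<close> whose coefficients lie in the controlled ring. On the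
  divisor \<open>X\<close> vanishes and \<open>T\<close> is a quotient of two affine functions of
  \<open>t\<close>, so that only the linear part of the conjugacy remains visible there. No limit is
  taken in this construction. For each \<open>j\<close> an integral up to terms of order
  \<open>2 * j + 1\<close> is enough, because giving \<open>x\<^sup>i t\<^sup>n\<close> the weight
  \<open>n + 2 i\<close> makes the coefficient \<open>f\<^sub>j\<close> appear exactly at weight
  \<open>2 * j + 1\<close>. Both the integration and the triangular recursion then divide only by
  integers up to \<open>2 * j + 1\<close>, which is the origin of the factorial.\<close>

definition csubring :: "complex set \<Rightarrow> bool" where
  "csubring R \<longleftrightarrow> 1 \<in> R \<and> (\<forall>a\<in>R. \<forall>b\<in>R. a - b \<in> R \<and> a * b \<in> R)"

context
  fixes R :: "complex set"
  assumes R: "csubring R"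
begin

lemma csubring_1: "1 \<in> R"
  using R by (simp add: csubring_def)

lemma csubring_diff: "a \<in> R \<Longrightarrow> b \<in> R \<Longrightarrow> a - b \<in> R"
  using R by (simp add: csubring_def)

lemma csubring_mult: "a \<in> R \<Longrightarrow> b \<in> R \<Longrightarrow> a * b \<in> R"
  using R by (simp add: csubring_def)

lemma csubring_0: "0 \<in> R"
  using csubring_diff[OF csubring_1 csubring_1] by simp

lemma csubring_uminus: "a \<in> R \<Longrightarrow> - a \<in> R"
  using csubring_diff[OF csubring_0, of a] by simp

lemma csubring_add: "a \<in> R \<Longrightarrow> b \<in> R \<Longrightarrow> a + b \<in> R"
  using csubring_diff[OF _ csubring_uminus, of a b] by simp

lemma csubring_power: "a \<in> R \<Longrightarrow> a ^ n \<in> R"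
  by (induction n) (auto intro: csubring_1 csubring_mult)

lemma csubring_sum: "(\<And>i. i \<in> I \<Longrightarrow> g i \<in> R) \<Longrightarrow> (\<Sum>i\<in>I. g i) \<in> R"
  by (induction I rule: infinite_finite_induct) (auto intro: csubring_0 csubring_add)

lemma csubring_of_nat: "of_nat n \<in> R"
  by (induction n) (auto intro: csubring_0 csubring_1 csubring_add)

lemma csubring_of_int: "of_int z \<in> R"
proof (cases z rule: int_cases2)
  case (nonneg n)
  then show ?thesis by (simp add: csubring_of_nat)
next
  case (nonpos n)
  then show ?thesis by (simp add: csubring_of_nat csubring_uminus)
qed

lemmas csubring_intros = csubring_0 csubring_1 csubring_diff csubring_mult csubring_add
  csubring_power csubring_sum csubring_of_nat csubring_of_int csubring_uminus

end

section \<open>Polynomials over a subring and adjunction of one element\<close>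

definition poly_over :: "complex set \<Rightarrow> complex poly set" where
  "poly_over R = {q. \<forall>i. coeff q i \<in> R}"

definition adjoin :: "complex set \<Rightarrow> complex \<Rightarrow> complex set" where
  "adjoin R c = (\<lambda>q. poly q c) ` poly_over R"

context
  fixes R :: "complex set"
  assumes R: "csubring R"
begin

lemma poly_over_diff: "p \<in> poly_over R \<Longrightarrow> q \<in> poly_over R \<Longrightarrow> p - q \<in> poly_over R"
  using R by (auto simp: poly_over_def csubring_intros)

lemma poly_over_add: "p \<in> poly_over R \<Longrightarrow> q \<in> poly_over R \<Longrightarrow> p + q \<in> poly_over R"
  using R by (auto simp: poly_over_def csubring_intros)

lemma poly_over_mult: "p \<in> poly_over R \<Longrightarrow> q \<in> poly_over R \<Longrightarrow> p * q \<in> poly_over R"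
  using R by (auto simp: poly_over_def coeff_mult intro!: csubring_sum csubring_mult)

lemma poly_over_monom: "a \<in> R \<Longrightarrow> monom a n \<in> poly_over R"
  using R by (auto simp: poly_over_def csubring_intros)

lemma poly_over_smult: "a \<in> R \<Longrightarrow> q \<in> poly_over R \<Longrightarrow> smult a q \<in> poly_over R"
  using R by (auto simp: poly_over_def csubring_intros)

lemma poly_over_const: "a \<in> R \<Longrightarrow> [:a:] \<in> poly_over R"
  using poly_over_monom[of a 0] by (simp add: monom_0)

lemma poly_over_power: "q \<in> poly_over R \<Longrightarrow> q ^ n \<in> poly_over R"
  using poly_over_const[OF csubring_1[OF R]]
  by (induction n) (auto intro: poly_over_mult simp: one_pCons)

lemma csubring_adjoin: "csubring (adjoin R c)"
  unfolding csubring_def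
proof (intro conjI ballI)
  show "1 \<in> adjoin R c"
    unfolding adjoin_def using poly_over_const[OF csubring_1[OF R]] by force
next
  fix u v assume "u \<in> adjoin R c" "v \<in> adjoin R c"
  then obtain p q where "p \<in> poly_over R" "q \<in> poly_over R" "u = poly p c" "v = poly q c"
    by (auto simp: adjoin_def)
  then show "u - v \<in> adjoin R c" "u * v \<in> adjoin R c"
    unfolding adjoin_def
    by (auto intro: image_eqI[of _ _ "p - q"] image_eqI[of _ _ "p * q"] poly_over_diff poly_over_mult)
qed

lemma adjoin_superset: "R \<subseteq> adjoin R c"
proof
  fix a assume "a \<in> R"
  then show "a \<in> adjoin R c"
    unfolding adjoin_def by (intro image_eqI[of _ _ "[:a:]"] poly_over_const) auto
qed

lemma adjoin_self: "c \<in> adjoin R c"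
  unfolding adjoin_def
  by (intro image_eqI[of _ _ "monom 1 1"] poly_over_monom csubring_1[OF R]) (auto simp: poly_monom)

text \<open>As \<open>R\<close> need not be a field, an ordinary division step could leave it.
  Multiplying the dividend by \<open>lead_coeff b\<close> before each subtraction keeps every
  coefficient in \<open>R\<close>, at the price of the power \<open>M\<close>.\<close>

lemma pseudo_division_over:
  assumes b: "b \<in> poly_over R" "b \<noteq> 0" and q: "q \<in> poly_over R"
  shows "\<exists>M s r. s \<in> poly_over R \<and> r \<in> poly_over R \<and>
    smult (lead_coeff b ^ M) q = s * b + r \<and> (r = 0 \<or> degree r < degree b)"
  using q
proof (induction "degree q" arbitrary: q rule: less_induct)
  case less
  let ?a = "lead_coeff b"
  have aR: "?a \<in> R" and a0: "?a \<noteq> 0" using b by (auto simp: poly_over_def)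
  show ?case
  proof (cases "degree q < degree b")
    case True
    then show ?thesis
      using less.prems poly_over_const[OF csubring_0[OF R]]
      by (intro exI[of _ 0] exI[of _ 0] exI[of _ q]) auto
  next
    case False
    define m where "m = monom (lead_coeff q) (degree q - degree b)"
    define q' where "q' = smult ?a q - m * b"
    have mR: "m \<in> poly_over R"
      unfolding m_def using less.prems by (intro poly_over_monom) (auto simp: poly_over_def)
    have q'R: "q' \<in> poly_over R"
      unfolding q'_def using less.prems aR b mR by (intro poly_over_diff poly_over_smult poly_over_mult)
    show ?thesis
    proof (cases "q' = 0 \<or> degree q' < degree q")
      case True
      have "\<exists>M s r. s \<in> poly_over R \<and> r \<in> poly_over R \<and>
        smult (?a ^ M) q' = s * b + r \<and> (r = 0 \<or> degree r < degree b)"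
      proof (cases "q' = 0")
        case True
        then show ?thesis
          using poly_over_const[OF csubring_0[OF R]]
          by (intro exI[of _ 0] exI[of _ 0] exI[of _ 0]) auto
      next
        case False
        with True less.hyps q'R show ?thesis by blast
      qed
      then obtain M s r where *: "s \<in> poly_over R" "r \<in> poly_over R"
        "smult (?a ^ M) q' = s * b + r" "r = 0 \<or> degree r < degree b" by blast
      have "smult (?a ^ Suc M) q = smult (?a ^ M) q' + smult (?a ^ M) (m * b)"
        unfolding q'_def by (simp add: smult_diff_right mult.commute)
      also have "\<dots> = (s + smult (?a ^ M) m) * b + r"
        using * by (simp add: algebra_simps)
      finally show ?thesis
        using * aR mR R by (intro exI[of _ "Suc M"] exI[of _ "s + smult (?a ^ M) m"] exI[of _ r])
          (auto intro!: poly_over_add poly_over_smult csubring_power)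
    next
      \<comment> \<open>The leading terms of \<open>smult ?a q\<close> and \<open>m * b\<close>
        cancel, so \<open>q'\<close> cannot be nonzero of the same degree as
        \<open>q\<close>.\<close>
      case contra: False
      have le: "degree q' \<le> degree q"
        unfolding q'_def m_def
        by (intro degree_diff_le order.trans[OF degree_smult_le] order.trans[OF degree_mult_le])
          (use False degree_monom_le[of "lead_coeff q" "degree q - degree b"] in auto)
      have "coeff q' (degree q) = ?a * lead_coeff q - coeff (m * b) (degree q - degree b + degree b)"
        using False by (simp add: q'_def)
      also have "coeff (m * b) (degree q - degree b + degree b) = lead_coeff q * ?a"
        unfolding m_def using coeff_monom_mult[of "lead_coeff q" "degree q - degree b" b "degree q - degree b + degree b"]
        by simp
      finally have "coeff q' (degree q) = 0" by simp
      moreover have "degree q' = degree q" "q' \<noteq> 0" using le contra by auto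
      ultimately show ?thesis by (metis leading_coeff_0_iff)
    qed
  qed
qed

end

text \<open>Asking for finitely many primes dividing powers of every nonzero element, and not only of
  \<open>1\<close>, makes the property pass from a ring to its extensions by one element.\<close>

definition few_primes :: "complex set \<Rightarrow> bool" where
  "few_primes R \<longleftrightarrow> (\<forall>f\<in>R. f \<noteq> 0 \<longrightarrow>
     finite {p::nat. prime p \<and> (\<exists>k. \<exists>u\<in>R. f ^ k = of_nat p * u)})"

lemma csubring_Ints: "csubring \<int>"
  by (auto simp: csubring_def)

lemma few_primes_Ints: "few_primes \<int>"
  unfolding few_primes_def
proof (intro ballI impI)
  fix f :: complex assume f: "f \<in> \<int>" "f \<noteq> 0"
  then obtain z where z: "f = of_int z" by (auto elim: Ints_cases)
  have "p \<le> nat \<bar>z\<bar>" if p: "prime p" and u: "u \<in> \<int>" and eq: "f ^ k = of_nat p * u" for p k u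
  proof -
    obtain w where w: "u = of_int w" using u by (auto elim: Ints_cases)
    have "(of_int (z ^ k) :: complex) = of_int (int p * w)"
      using eq z w by simp
    then have "int p dvd z ^ k" by (metis dvd_triv_left of_int_eq_iff)
    then have "int p dvd z" using p prime_dvd_power by (metis prime_nat_int_transfer)
    moreover have "z \<noteq> 0" using z f by auto
    ultimately have "int p \<le> \<bar>z\<bar>" by (metis abs_of_nat dvd_imp_le_int)
    then show ?thesis by simp
  qed
  then show "finite {p. prime p \<and> (\<exists>k. \<exists>u\<in>\<int>. f ^ k = of_nat p * u)}"
    by (intro finite_subset[OF _ finite_atMost[of "nat \<bar>z\<bar>"]]) auto
qed

text \<open>Evaluation at \<open>c\<close> is injective on \<open>poly_over R\<close>, so
  \<open>g ^ k = of_nat p * u\<close> lifts to an identity of polynomials. Its top coefficient shows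
  that \<open>p\<close> divides a power of the leading coefficient of \<open>q\<close>, an element
  of \<open>R\<close> that does not depend on \<open>p\<close>.\<close>

lemma few_primes_adjoin_transcendental:
  assumes R: "csubring R" "few_primes R"
    and tr: "\<And>q. q \<in> poly_over R \<Longrightarrow> poly q c = 0 \<Longrightarrow> q = 0"
  shows "few_primes (adjoin R c)"
  unfolding few_primes_def
proof (intro ballI impI)
  fix g assume "g \<in> adjoin R c" and g0: "g \<noteq> 0"
  then obtain q where q: "q \<in> poly_over R" "g = poly q c" by (auto simp: adjoin_def)
  have q0: "q \<noteq> 0" using q g0 by auto
  let ?f = "lead_coeff q"
  have fR: "?f \<in> R" "?f \<noteq> 0" using q q0 by (auto simp: poly_over_def)
  have "\<exists>k. \<exists>v\<in>R. ?f ^ k = of_nat p * v" if u: "u \<in> adjoin R c" and eq: "g ^ k = of_nat p * u" for p u k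
  proof -
    obtain w where w: "w \<in> poly_over R" "u = poly w c" using u by (auto simp: adjoin_def)
    have "poly (q ^ k - smult (of_nat p) w) c = 0" using eq q w by simp
    then have "q ^ k - smult (of_nat p) w = 0"
      using R q w by (intro tr poly_over_diff poly_over_power poly_over_smult csubring_of_nat) auto
    then have "coeff (q ^ k) (degree (q ^ k)) = of_nat p * coeff w (degree (q ^ k))" by simp
    then have "?f ^ k = of_nat p * coeff w (degree (q ^ k))" by (simp only: lead_coeff_power)
    then show ?thesis using w by (auto simp: poly_over_def)
  qed
  then have "{p. prime p \<and> (\<exists>k. \<exists>u\<in>adjoin R c. g ^ k = of_nat p * u)} \<subseteq>
      {p. prime p \<and> (\<exists>k. \<exists>u\<in>R. ?f ^ k = of_nat p * u)}" by blast
  moreover have "finite {p::nat. prime p \<and> (\<exists>k. \<exists>u\<in>R. ?f ^ k = of_nat p * u)}"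
    using R(2) fR unfolding few_primes_def by blast
  ultimately show "finite {p::nat. prime p \<and> (\<exists>k. \<exists>u\<in>adjoin R c. g ^ k = of_nat p * u)}"
    by (rule finite_subset)
qed

text \<open>Some nonzero multiple \<open>f\<close> of \<open>g\<close> lies in \<open>R\<close>, and
  a prime dividing a power of \<open>g\<close> divides the same power of \<open>f\<close> in
  \<open>adjoin R c\<close>. To descend to \<open>R\<close>, a power of the leading coefficient of
  \<open>m\<close> clears denominators; representatives of degree below that of \<open>m\<close> are
  unique by minimality, so constant coefficients can be compared.\<close>

lemma few_primes_adjoin_algebraic:
  assumes R: "csubring R" "few_primes R"
    and m: "m \<in> poly_over R" "m \<noteq> 0" "poly m c = 0"
    and min: "\<And>q. q \<in> poly_over R \<Longrightarrow> poly q c = 0 \<Longrightarrow> degree q < degree m \<Longrightarrow> q = 0"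
  shows "few_primes (adjoin R c)"
  unfolding few_primes_def
proof (intro ballI impI)
  fix g assume gA: "g \<in> adjoin R c" and g0: "g \<noteq> 0"
  let ?A = "adjoin R c"
  have A: "csubring ?A" by (rule csubring_adjoin[OF R(1)])
  have deg: "degree m > 0"
    proof (rule ccontr)
    assume "\<not> degree m > 0"
    then obtain b where "m = [:b:]" by (auto elim: degree_eq_zeroE)
    then show False using m by simp
  qed
  let ?a = "lead_coeff m"
  have aR: "?a \<in> R" "?a \<noteq> 0" using m by (auto simp: poly_over_def)
  have reduce: "\<exists>M. \<exists>r\<in>poly_over R. degree r < degree m \<and> ?a ^ M * u = poly r c" if u: "u \<in> ?A" for u
  proof -
    obtain q where q: "q \<in> poly_over R" "u = poly q c" using u by (auto simp: adjoin_def)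
    obtain M s r where *: "r \<in> poly_over R" "smult (?a ^ M) q = s * m + r"
      "r = 0 \<or> degree r < degree m"
      using pseudo_division_over[OF R(1) m(1,2) q(1)] by blast
    have "poly (smult (?a ^ M) q) c = poly r c" unfolding * using m by simp
    then have "?a ^ M * u = poly r c" using q by simp
    moreover have "degree r < degree m" using * deg by auto
    ultimately show ?thesis using * by blast
  qed
  \<comment> \<open>A member of \<open>E\<close> of least degree must be constant. Otherwise
    pseudo-division of \<open>m\<close> by it, evaluated at \<open>c\<close>, would leave a smaller
    member of \<open>E\<close>, or a nonzero polynomial of lower degree than \<open>m\<close>
    vanishing at \<open>c\<close>.\<close>
  define E where "E = {e \<in> poly_over R. e \<noteq> 0 \<and> degree e < degree m \<and> (\<exists>h\<in>?A. poly e c = g * h)}"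
  obtain M e0 where e0: "e0 \<in> poly_over R" "degree e0 < degree m" "?a ^ M * g = poly e0 c"
    using reduce[OF gA] by blast
  have "?a ^ M \<in> ?A" using adjoin_superset[OF R(1)] csubring_power[OF R(1) aR(1)] by blast
  moreover have "e0 \<noteq> 0" using e0 aR g0 by auto
  ultimately have "e0 \<in> E"
    using e0 unfolding E_def by (auto intro!: bexI[of _ "?a ^ M"] simp: mult.commute)
  then obtain e where e: "e \<in> E" and emin: "\<And>e'. e' \<in> E \<Longrightarrow> degree e \<le> degree e'"
    using ex_has_least_nat[of "\<lambda>e. e \<in> E" e0 degree] by blast
  obtain h where h: "h \<in> ?A" "poly e c = g * h" using e by (auto simp: E_def)
  have eR: "e \<in> poly_over R" "e \<noteq> 0" "degree e < degree m" using e by (auto simp: E_def)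
  have ec: "poly e c \<noteq> 0" using eR min by blast
  have "degree e = 0"
  proof (rule ccontr)
    assume ne: "degree e \<noteq> 0"
    obtain M s r where *: "s \<in> poly_over R" "r \<in> poly_over R"
      "smult (lead_coeff e ^ M) m = s * e + r" "r = 0 \<or> degree r < degree e"
      using pseudo_division_over[OF R(1) eR(1,2) m(1)] by blast
    have "poly (smult (lead_coeff e ^ M) m) c = poly (s * e + r) c" unfolding * ..
    then have rc: "poly r c = - (poly s c * poly e c)"
      using m by (simp add: eq_neg_iff_add_eq_0 add.commute)
    show False
    proof (cases "r = 0")
      case True
      then have sc: "poly s c = 0" using rc ec by simp
      have eq: "smult (lead_coeff e ^ M) m = s * e" using * True by simp
      have "smult (lead_coeff e ^ M) m \<noteq> 0" using eR m by simp
      then have se: "s * e \<noteq> 0" unfolding eq .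
      have "degree m = degree (smult (lead_coeff e ^ M) m)" using eR by simp
      also have "\<dots> = degree s + degree e" unfolding eq using se by (intro degree_mult_eq) auto
      finally have "degree m = degree s + degree e" .
      then have "degree s < degree m" using ne by simp
      then have "s = 0" using min * sc by blast
      then show False using se by simp
    next
      case False
      have "poly s c \<in> ?A" using * by (auto simp: adjoin_def)
      then have "- (poly s c * h) \<in> ?A" using A h by (auto intro: csubring_intros)
      moreover have "poly r c = g * (- (poly s c * h))" using rc h by (simp add: algebra_simps)
      moreover have "degree r < degree e" using * False by simp
      ultimately show False using * False eR emin[of r] unfolding E_def by force
    qed
  qed
  then obtain f where f: "e = [:f:]" by (metis degree_eq_zeroE)
  have fR: "f \<in> R" "f \<noteq> 0" "f = g * h"
    using eR f h by (auto simp: poly_over_def dest: spec[of _ 0])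
  have "\<exists>k. \<exists>v\<in>R. (f * ?a) ^ k = of_nat p * v" if "u \<in> ?A" "g ^ k = of_nat p * u" for p u k
  proof -
    have "u * h ^ k \<in> ?A" using A that h by (auto intro: csubring_intros)
    then obtain M r where r: "r \<in> poly_over R" "degree r < degree m"
      "?a ^ M * (u * h ^ k) = poly r c" using reduce by blast
    have eq: "f ^ k * ?a ^ M = of_nat p * poly r c"
      unfolding r(3)[symmetric] fR(3) power_mult_distrib that(2) by (simp add: algebra_simps)
    \<comment> \<open>This polynomial vanishes at \<open>c\<close> and has degree below that of
      \<open>m\<close>, hence it is zero; its constant coefficient is an identity in
      \<open>R\<close>.\<close>
    have "poly ([:f ^ k * ?a ^ M:] - smult (of_nat p) r) c = 0" using eq by simp
    moreover have "[:f ^ k * ?a ^ M:] - smult (of_nat p) r \<in> poly_over R"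
      using R r fR aR
      by (intro poly_over_diff poly_over_smult poly_over_const csubring_mult csubring_power csubring_of_nat)
    moreover have "degree ([:f ^ k * ?a ^ M:] - smult (of_nat p) r) < degree m"
      using r deg by (intro degree_diff_less) (auto intro: le_less_trans[OF degree_smult_le])
    ultimately have "[:f ^ k * ?a ^ M:] - smult (of_nat p) r = 0" using min by blast
    then have "coeff ([:f ^ k * ?a ^ M:] - smult (of_nat p) r) 0 = 0" by simp
    then have "f ^ k * ?a ^ M = of_nat p * coeff r 0" by simp
    \<comment> \<open>The factor \<open>f ^ M * ?a ^ k\<close> makes the two exponents equal, so
      that one element \<open>f * ?a\<close> serves for all \<open>p\<close>.\<close>
    then have "(f * ?a) ^ (k + M) = of_nat p * (coeff r 0 * f ^ M * ?a ^ k)"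
      by (simp add: power_add power_mult_distrib algebra_simps)
    moreover have "coeff r 0 * f ^ M * ?a ^ k \<in> R"
      using R r fR aR by (auto simp: poly_over_def intro!: csubring_mult csubring_power)
    ultimately show ?thesis by blast
  qed
  then have "{p. prime p \<and> (\<exists>k. \<exists>u\<in>adjoin R c. g ^ k = of_nat p * u)} \<subseteq>
      {p. prime p \<and> (\<exists>k. \<exists>u\<in>R. (f * ?a) ^ k = of_nat p * u)}" by blast
  moreover have "f * ?a \<in> R" "f * ?a \<noteq> 0"
    using csubring_mult[OF R(1) fR(1) aR(1)] fR(2) aR(2) by simp_all
  then have "finite {p::nat. prime p \<and> (\<exists>k. \<exists>u\<in>R. (f * ?a) ^ k = of_nat p * u)}"
    using R(2) unfolding few_primes_def by blast
  ultimately show "finite {p::nat. prime p \<and> (\<exists>k. \<exists>u\<in>adjoin R c. g ^ k = of_nat p * u)}"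
    by (rule finite_subset)
qed

lemma few_primes_adjoin:
  assumes "csubring R" "few_primes R"
  shows "few_primes (adjoin R c)"
proof (cases "\<exists>q. q \<in> poly_over R \<and> q \<noteq> 0 \<and> poly q c = 0")
  case True
  then obtain q0 where "q0 \<in> poly_over R \<and> q0 \<noteq> 0 \<and> poly q0 c = 0" by blast
  from ex_has_least_nat[where P = "\<lambda>q. q \<in> poly_over R \<and> q \<noteq> 0 \<and> poly q c = 0" and m = degree, OF this]
  obtain m where m: "m \<in> poly_over R" "m \<noteq> 0" "poly m c = 0"
    and min: "\<And>q. q \<in> poly_over R \<and> q \<noteq> 0 \<and> poly q c = 0 \<Longrightarrow> degree m \<le> degree q"
    by blast
  show ?thesis
  proof (rule few_primes_adjoin_algebraic[OF assms m])
    fix q assume q: "q \<in> poly_over R" "poly q c = 0" "degree q < degree m"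
    show "q = 0" using min[of q] q by (cases "q = 0") auto
  qed
next
  case False
  then show ?thesis using few_primes_adjoin_transcendental[OF assms] by blast
qed

lemma finitely_generated_few_primes:
  assumes "finite C"
  shows "\<exists>R. csubring R \<and> few_primes R \<and> C \<subseteq> R"
  using assms
proof induction
  case empty
  then show ?case using csubring_Ints few_primes_Ints by auto
next
  case (insert c C)
  then obtain R where R: "csubring R" "few_primes R" "C \<subseteq> R" by blast
  then have "insert c C \<subseteq> adjoin R c"
    using adjoin_superset[OF R(1), of c] adjoin_self[OF R(1), of c] by auto
  then show ?case
    using csubring_adjoin[OF R(1)] few_primes_adjoin[OF R(1,2)] by blast
qed

section \<open>The localization \<open>R[1/N!]\<close>\<close>

definition loc :: "complex set \<Rightarrow> nat \<Rightarrow> complex set" where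
  "loc R N = {z. \<exists>k. fact N ^ k * z \<in> R}"

context
  fixes R :: "complex set"
  assumes R: "csubring R"
begin

lemma loc_superset: "R \<subseteq> loc R N"
  unfolding loc_def by (auto intro!: exI[of _ 0])

lemma csubring_loc: "csubring (loc R N)"
  unfolding csubring_def
proof (intro conjI ballI)
  show "1 \<in> loc R N" using loc_superset csubring_1[OF R] by blast
next
  fix u v assume "u \<in> loc R N" "v \<in> loc R N"
  then obtain k l where kl: "fact N ^ k * u \<in> R" "fact N ^ l * v \<in> R" by (auto simp: loc_def)
  have F: "fact N ^ j \<in> R" for j
    using csubring_power[OF R csubring_of_nat[OF R, of "fact N"]] by simp
  have "fact N ^ (k + l) * (u - v) = fact N ^ l * (fact N ^ k * u) - fact N ^ k * (fact N ^ l * v)"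
    by (simp add: power_add algebra_simps)
  also have "\<dots> \<in> R" by (rule csubring_diff[OF R csubring_mult[OF R F kl(1)] csubring_mult[OF R F kl(2)]])
  finally show "u - v \<in> loc R N" unfolding loc_def by blast
  have "fact N ^ (k + l) * (u * v) = (fact N ^ k * u) * (fact N ^ l * v)"
    by (simp add: power_add algebra_simps)
  also have "\<dots> \<in> R" by (rule csubring_mult[OF R kl])
  finally show "u * v \<in> loc R N" unfolding loc_def by blast
qed

lemma loc_inverse:
  assumes "0 < m" "m \<le> N"
  shows "1 / of_nat m \<in> loc R N"
proof -
  obtain q where q: "(fact N :: nat) = m * q" using dvd_fact[of m N] assms by (auto elim: dvdE)
  have "(fact N :: complex) = of_nat (fact N)" by simp
  also have "\<dots> = of_nat m * of_nat q" unfolding q by simp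
  finally have "(fact N :: complex) ^ 1 * (1 / of_nat m) = of_nat q" using assms by simp
  then have "(fact N :: complex) ^ 1 * (1 / of_nat m) \<in> R" using csubring_of_nat[OF R] by simp
  then show ?thesis unfolding loc_def by blast
qed

text \<open>Since \<open>p\<close> is coprime to \<open>fact N ^ k\<close>, a Bezout relation
  \<open>u * fact N ^ k + v * p = 1\<close> divided by \<open>p\<close> writes \<open>1 / p\<close>
  as an integer combination of \<open>fact N ^ k / p\<close> and \<open>1\<close>, both in
  \<open>R\<close>.\<close>

lemma loc_inverse_prime:
  assumes "prime p" "N < p" "1 / of_nat p \<in> loc R N"
  shows "1 / of_nat p \<in> R"
proof -
  obtain k where k: "fact N ^ k * (1 / of_nat p) \<in> R" using assms by (auto simp: loc_def)
  have "\<not> p dvd fact N" using assms by (simp add: prime_dvd_fact_iff)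
  then have "coprime (fact N ^ k) p"
    using prime_imp_coprime[OF assms(1), of "fact N"] by (simp add: coprime_commute)
  then have "coprime (int (fact N ^ k)) (int p)" by (simp only: coprime_int_iff)
  then obtain u v where "u * int (fact N ^ k) + v * int p = 1"
    using bezout_int[of "int (fact N ^ k)" "int p"] by (metis coprime_iff_gcd_eq_1)
  then have "of_int (u * int (fact N ^ k) + v * int p) = (1::complex)" by simp
  then have "of_int u * fact N ^ k + of_int v * of_nat p = (1::complex)" by simp
  moreover have "of_nat p \<noteq> (0::complex)" using assms by auto
  ultimately have "1 / of_nat p = of_int u * (fact N ^ k * (1 / of_nat p)) + (of_int v :: complex)"
    by (simp add: field_simps)
  also have "\<dots> \<in> R"
    by (rule csubring_add[OF R csubring_mult[OF R csubring_of_int[OF R] k] csubring_of_int[OF R]])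
  finally show ?thesis .
qed

end

section \<open>Formal first integrals\<close>

definition cc :: "complex \<Rightarrow> complex fps fps" where
  "cc c = fps_const (fps_const c)"

lemma cc_add: "cc (a + b) = cc a + cc b"
  by (simp add: cc_def)

lemma cc_mult: "cc (a * b) = cc a * cc b"
  by (simp add: cc_def)

lemma cc_0 [simp]: "cc 0 = 0"
  by (simp add: cc_def)

lemma cc_1 [simp]: "cc 1 = 1"
  by (simp add: cc_def)

lemma cc_uminus: "cc (- a) = - cc a"
  by (simp add: cc_def)

lemma cc_of_nat: "cc (of_nat n) = of_nat n"
  by (induction n) (simp_all add: cc_add)

lemma fps2_mult_nth:
  "(F * G) $ n $ i = (\<Sum>k\<le>n. \<Sum>j\<le>i. F $ k $ j * (G :: complex fps fps) $ (n - k) $ (i - j))"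
  by (simp add: fps_mult_nth fps_sum_nth atLeast0AtMost)

definition ord_ge :: "nat \<Rightarrow> complex fps fps \<Rightarrow> bool" where
  "ord_ge N F \<longleftrightarrow> (\<forall>n i. n + i < N \<longrightarrow> F $ n $ i = 0)"

lemma ord_ge_0 [simp]: "ord_ge 0 F"
  by (simp add: ord_ge_def)

lemma ord_ge_add: "ord_ge N F \<Longrightarrow> ord_ge N G \<Longrightarrow> ord_ge N (F + G)"
  by (simp add: ord_ge_def)

lemma ord_ge_mono: "ord_ge N F \<Longrightarrow> M \<le> N \<Longrightarrow> ord_ge M F"
  by (simp add: ord_ge_def)

lemma ord_ge_mult:
  assumes "ord_ge N F" "ord_ge M G"
  shows "ord_ge (N + M) (F * G)"
  unfolding ord_ge_def
proof (intro allI impI)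
  fix n i assume ni: "n + i < N + M"
  have "F $ k $ j * G $ (n - k) $ (i - j) = 0" if "k \<le> n" "j \<le> i" for k j
  proof (cases "k + j < N")
    case True
    then show ?thesis using assms by (simp add: ord_ge_def)
  next
    case False
    then have "(n - k) + (i - j) < M" using ni that by linarith
    then show ?thesis using assms by (simp add: ord_ge_def)
  qed
  then show "(F * G) $ n $ i = 0" unfolding fps2_mult_nth by (intro sum.neutral ballI) auto
qed

lemma ord_ge_power: "ord_ge 1 F \<Longrightarrow> ord_ge n (F ^ n)"
proof (induction n)
  case (Suc n)
  then show ?case using ord_ge_mult[of 1 F n "F ^ n"] by simp
qed simp

lemma fps2_unit:
  assumes "(u :: complex fps fps) $ 0 $ 0 \<noteq> 0"
  obtains v where "u * v = 1"
proof -
  have "u $ 0 * inverse (u $ 0) = 1" using assms by (simp add: inverse_mult_eq_1')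
  then show ?thesis using fps_right_inverse that by blast
qed

section \<open>Derivations on double power series\<close>

definition inner_deriv :: "complex fps fps \<Rightarrow> complex fps fps" where
  "inner_deriv F = Abs_fps (\<lambda>n. fps_deriv (F $ n))"

lemma inner_deriv_nth: "inner_deriv F $ n = fps_deriv (F $ n)"
  by (simp add: inner_deriv_def)

lemma inner_deriv_add: "inner_deriv (F + G) = inner_deriv F + inner_deriv G"
  by (simp add: fps_eq_iff inner_deriv_nth algebra_simps)

lemma inner_deriv_mult: "inner_deriv (F * G) = inner_deriv F * G + F * inner_deriv G"
proof (rule fps_ext)
  fix n
  have "inner_deriv (F * G) $ n = (\<Sum>i=0..n. fps_deriv (F $ i * G $ (n - i)))"
    by (simp add: inner_deriv_nth fps_mult_nth fps_deriv_sum)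
  also have "\<dots> = (inner_deriv F * G + F * inner_deriv G) $ n"
    by (simp add: fps_mult_nth inner_deriv_nth sum.distrib add.commute)
  finally show "inner_deriv (F * G) $ n = (inner_deriv F * G + F * inner_deriv G) $ n" .
qed

lemma inner_deriv_cc [simp]: "inner_deriv (cc c) = 0"
proof (rule fps_ext)
  fix n show "inner_deriv (cc c) $ n = 0 $ n"
    by (cases n) (simp_all add: inner_deriv_nth cc_def)
qed

text \<open>The field \<open>(t + f(x)) \<partial>\<^sub>x + \<partial>\<^sub>t\<close>, with \<open>t\<close> the outer and \<open>x\<close> the inner variable.\<close>

definition vfield :: "complex fps \<Rightarrow> complex fps fps \<Rightarrow> complex fps fps" where
  "vfield f F = (fps_X + fps_const f) * inner_deriv F + fps_deriv F"

lemma vfield_add: "vfield f (F + G) = vfield f F + vfield f G"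
  by (simp add: vfield_def inner_deriv_add algebra_simps)

lemma vfield_mult: "vfield f (F * G) = vfield f F * G + F * vfield f G"
  by (simp add: vfield_def inner_deriv_mult algebra_simps)

lemma vfield_cc [simp]: "vfield f (cc c) = 0"
  by (simp add: vfield_def) (simp add: cc_def)

lemma vfield_cc_mult: "vfield f (cc c * F) = cc c * vfield f F"
  by (simp add: vfield_mult)

lemma vfield_diff: "vfield f (F - G) = vfield f F - vfield f G"
  using vfield_add[of f F "cc (-1) * G"] unfolding vfield_cc_mult by (simp add: cc_uminus)

lemma vfield_power: "vfield f (F ^ n) = of_nat n * F ^ (n - 1) * vfield f F"
proof -
  have Suc: "vfield f (F ^ Suc n) = of_nat (Suc n) * F ^ n * vfield f F" for n
    by (induction n) (simp_all add: vfield_mult algebra_simps)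
  show ?thesis using Suc vfield_cc[of f 1] by (cases n) auto
qed

lemma vfield_nth:
  "vfield f F $ n $ i = of_nat (n + 1) * F $ (n + 1) $ i
     + (if n = 0 then 0 else of_nat (i + 1) * F $ (n - 1) $ (i + 1))
     + (\<Sum>j\<le>i. f $ j * (of_nat (i - j + 1) * F $ n $ (i - j + 1)))"
proof -
  have "(of_nat (n + 1) * F $ (n + 1)) $ i = of_nat (n + 1) * F $ (n + 1) $ i"
    by (metis fps_mult_left_const_nth fps_of_nat)
  moreover have "(f * fps_deriv (F $ n)) $ i =
      (\<Sum>j\<le>i. f $ j * (of_nat (i - j + 1) * F $ n $ (i - j + 1)))"
    by (simp add: fps_mult_nth atLeast0AtMost)
  ultimately show ?thesis
    unfolding vfield_def distrib_right fps_add_nth fps_X_mult_nth fps_mult_left_const_nth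
      inner_deriv_nth fps_deriv_nth
    by (simp del: of_nat_add)
qed

text \<open>Induction on the weight \<open>n + 2 i\<close> of \<open>x\<^sup>i t\<^sup>n\<close>: in the coefficient equations of
  \<open>vfield f K = 0\<close> all terms but the first two have smaller weight, except for
  \<open>f\<^sub>j K $ 0 $ 1\<close> in the equation for \<open>x\<^sup>j\<close>.\<close>

lemma field_coeff_in_ring:
  assumes R: "csubring R"
    and inv: "\<And>m. 0 < m \<Longrightarrow> m \<le> W \<Longrightarrow> 1 / of_nat m \<in> R"
    and f0: "f $ 0 = 0"
    and van: "ord_ge W (vfield f K)"
    and K0: "\<And>n. K $ n $ 0 \<in> R"
    and g: "K $ 0 $ 1 \<noteq> 0" "1 / K $ 0 $ 1 \<in> R"
  shows "w \<le> W \<Longrightarrow> (\<forall>n i. n + 2 * i \<le> w \<longrightarrow> K $ n $ i \<in> R) \<and> (\<forall>j. 2 * j + 1 \<le> w \<longrightarrow> f $ j \<in> R)"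
proof (induction w)
  case 0
  then show ?case using K0 by simp
next
  case (Suc w)
  then have IH: "\<And>n i. n + 2 * i \<le> w \<Longrightarrow> K $ n $ i \<in> R" "\<And>j. 2 * j + 1 \<le> w \<Longrightarrow> f $ j \<in> R"
    by auto
  \<comment> \<open>Here \<open>n + i \<le> w < W\<close>, so the assumed vanishing order covers
    this coefficient.\<close>
  have rec: "of_nat (n + 1) * K $ (n + 1) $ i
     + (if n = 0 then 0 else of_nat (i + 1) * K $ (n - 1) $ (i + 1))
     + (\<Sum>j\<le>i. f $ j * (of_nat (i - j + 1) * K $ n $ (i - j + 1))) = 0"
    if "n + 2 * i = w" for n i
    using van that Suc.prems unfolding vfield_nth[symmetric] ord_ge_def by simp
  \<comment> \<open>The term \<open>j = 0\<close> would involve a coefficient of weight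
    \<open>w + 2\<close>, but \<open>f $ 0 = 0\<close>. The condition
    \<open>2 * j + 1 \<le> w\<close> excludes only \<open>n = 0\<close>,
    \<open>j = i\<close>.\<close>
  have lower: "f $ j * (of_nat (i - j + 1) * K $ n $ (i - j + 1)) \<in> R"
    if "n + 2 * i = w" "j \<le> i" "2 * j + 1 \<le> w" for n i j
  proof (cases "j = 0")
    case True
    then show ?thesis using f0 csubring_0[OF R] by simp
  next
    case False
    then show ?thesis using that
      by (intro csubring_mult[OF R] csubring_of_nat[OF R] IH) auto
  qed
  \<comment> \<open>The walk follows the line of weight \<open>w + 1\<close>, starting at the known
    divisor coefficient \<open>K $ (w + 1) $ 0\<close>. Each equation trades
    \<open>t\<^sup>2\<close> for \<open>x\<close> and costs a division by
    \<open>i + 1\<close>.\<close>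
  have new: "K $ (Suc w - 2 * i) $ i \<in> R" if "2 * i \<le> Suc w" for i
    using that
  proof (induction i)
    case 0
    then show ?case using K0 by simp
  next
    case (Suc i)
    define n where "n = w - 2 * i"
    have n: "n + 2 * i = w" "n \<noteq> 0" "Suc w - 2 * i = n + 1" "Suc w - 2 * Suc i = n - 1"
      using Suc.prems by (auto simp: n_def)
    have "K $ (n + 1) $ i \<in> R" using Suc n by simp
    then have "- (of_nat (n + 1) * K $ (n + 1) $ i
      + (\<Sum>j\<le>i. f $ j * (of_nat (i - j + 1) * K $ n $ (i - j + 1)))) \<in> R" (is "?z \<in> R")
      using n by (intro csubring_uminus[OF R] csubring_add[OF R] csubring_mult[OF R]
        csubring_of_nat[OF R] csubring_sum[OF R] lower) auto
    moreover have "of_nat (i + 1) * K $ (n - 1) $ (i + 1) = ?z"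
      using rec[OF n(1)] n(2) by (simp add: algebra_simps eq_neg_iff_add_eq_0)
    ultimately have "of_nat (i + 1) * K $ (n - 1) $ (i + 1) \<in> R" by (simp only:)
    moreover have "1 / of_nat (i + 1) \<in> R"
      using Suc.prems \<open>Suc w \<le> W\<close> by (intro inv) auto
    ultimately have "1 / of_nat (i + 1) * (of_nat (i + 1) * K $ (n - 1) $ (i + 1)) \<in> R"
      using csubring_mult[OF R] by blast
    moreover have "of_nat (i + 1) \<noteq> (0::complex)" by (simp only: of_nat_eq_0_iff)
    ultimately show ?case using n by (simp del: of_nat_add of_nat_Suc)
  qed
  have A: "K $ n $ i \<in> R" if "n + 2 * i \<le> Suc w" for n i
  proof (cases "n + 2 * i = Suc w")
    case True
    then show ?thesis using new[of i] by (metis add_diff_cancel_right' le_add2)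
  next
    case False
    then show ?thesis using that IH by simp
  qed
  have B: "f $ j \<in> R" if j: "2 * j + 1 \<le> Suc w" for j
  proof (cases "2 * j + 1 = Suc w")
    case True
    then have w: "0 + 2 * j = w" by simp
    \<comment> \<open>For \<open>n = 0\<close> there is no term in \<open>K $ (n - 1)\<close>, and
      the last summand is \<open>f $ j * K $ 0 $ 1\<close>; all the others are already in
      \<open>R\<close>.\<close>
    have "- (K $ 1 $ j + (\<Sum>k<j. f $ k * (of_nat (j - k + 1) * K $ 0 $ (j - k + 1)))) \<in> R" (is "?z \<in> R")
      using w by (intro csubring_uminus[OF R] csubring_add[OF R] csubring_sum[OF R] lower A) auto
    moreover have "f $ j * K $ 0 $ 1 = ?z"
      using rec[OF w] by (simp add: lessThan_Suc_atMost[symmetric] eq_neg_iff_add_eq_0 algebra_simps)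
    ultimately have "f $ j * K $ 0 $ 1 \<in> R" by (simp only:)
    then have "f $ j * K $ 0 $ 1 * (1 / K $ 0 $ 1) \<in> R"
      using csubring_mult[OF R _ g(2)] by blast
    then show ?thesis using g by simp
  next
    case False
    then show ?thesis using that IH by simp
  qed
  show ?case using A B by blast
qed

inductive_set mspan :: "complex set \<Rightarrow> complex fps fps \<Rightarrow> complex fps fps \<Rightarrow> nat \<Rightarrow> complex fps fps set"
  for R X T N where
    mspan_monom: "r \<in> R \<Longrightarrow> N \<le> i + n \<Longrightarrow> cc r * X ^ i * T ^ n \<in> mspan R X T N"
  | mspan_add: "u \<in> mspan R X T N \<Longrightarrow> v \<in> mspan R X T N \<Longrightarrow> u + v \<in> mspan R X T N"

locale mspan_ring =
  fixes R :: "complex set" and X T :: "complex fps fps"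
  assumes R: "csubring R"
begin

abbreviation J where "J \<equiv> mspan R X T"

lemma J_0: "0 \<in> J N"
  using mspan_monom[OF csubring_0[OF R], of N N 0 X T] by simp

lemma J_mono: "u \<in> J N \<Longrightarrow> M \<le> N \<Longrightarrow> u \<in> J M"
  by (induction rule: mspan.induct) (auto intro: mspan.intros)

lemma J_mult:
  assumes "u \<in> J N" "v \<in> J M"
  shows "u * v \<in> J (N + M)"
  using assms(1)
proof induction
  case (mspan_monom r i n)
  show ?case using assms(2)
  proof induction
    case (mspan_monom s k l)
    have "cc r * X ^ i * T ^ n * (cc s * X ^ k * T ^ l) = cc (r * s) * X ^ (i + k) * T ^ (n + l)"
      by (simp add: cc_mult power_add algebra_simps)
    also have "\<dots> \<in> J (N + M)"
      using mspan_monom \<open>r \<in> R\<close> \<open>N \<le> i + n\<close> by (intro mspan.mspan_monom csubring_mult[OF R]) auto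
    finally show ?case .
  qed (auto simp: ring_distribs intro: mspan_add)
qed (auto simp: ring_distribs intro: mspan_add)

lemma J_cc: "r \<in> R \<Longrightarrow> cc r \<in> J 0"
  using mspan_monom[of r R 0 0 0 X T] by simp

lemma J_X: "X \<in> J 1"
  using mspan_monom[OF csubring_1[OF R], of 1 1 0 X T] by simp

lemma J_T: "T \<in> J 1"
  using mspan_monom[OF csubring_1[OF R], of 1 0 1 X T] by simp

lemma J_uminus: "u \<in> J N \<Longrightarrow> - u \<in> J N"
  using J_mult[OF J_cc[OF csubring_uminus[OF R csubring_1[OF R]]], of u N] by (simp add: cc_uminus)

lemma J_diff: "u \<in> J N \<Longrightarrow> v \<in> J N \<Longrightarrow> u - v \<in> J N"
  using mspan_add[OF _ J_uminus, of u N v] by simp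

lemma J_power: "u \<in> J 0 \<Longrightarrow> u ^ n \<in> J 0"
  using J_cc[OF csubring_1[OF R]] J_mult[of u 0 _ 0] by (induction n) auto

lemma J_sum: "(\<And>i. i \<in> I \<Longrightarrow> g i \<in> J N) \<Longrightarrow> (\<Sum>i\<in>I. g i) \<in> J N"
  by (induction I rule: infinite_finite_induct) (auto intro: J_0 mspan_add)

end

text \<open>The equation \<open>conj\<close> is the blown-up polynomial foliation
  \<open>dX/dT = (T + X E) / (b + X G)\<close> along the solutions of
  \<open>dx/dt = t + f(x)\<close>, with denominators cleared.\<close>

locale formal_conjugacy = mspan_ring +
  fixes f :: "complex fps" and E G :: "complex fps fps" and b :: complex
  assumes b: "b \<noteq> 0" "1 / b \<in> R"
    and E: "E \<in> mspan R X T 0" and G: "G \<in> mspan R X T 0"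
    and conj: "(cc b + X * G) * vfield f X = (T + X * E) * vfield f T"
begin

text \<open>Integrating the lowest-order terms with respect to \<open>T\<close> is all that is needed to push the
  defect of an approximate first integral one order higher.\<close>

lemma J_correction:
  assumes "u \<in> J N" and inv: "\<And>m. 0 < m \<Longrightarrow> m \<le> Suc N \<Longrightarrow> 1 / of_nat m \<in> R"
  shows "\<exists>C\<in>J (Suc N). \<exists>u'\<in>J (Suc N). (cc b + X * G) * vfield f C = (u - u') * vfield f T"
  using assms(1)
proof induction
  case (mspan_monom r i n)
  show ?case
  proof (cases "N = i + n")
    case False
    then have "cc r * X ^ i * T ^ n \<in> J (Suc N)"
      using mspan_monom by (intro mspan.mspan_monom) auto
    moreover have "vfield f 0 = 0" using vfield_cc[of f 0] by simp
    ultimately show ?thesis using J_0 by (intro bexI[of _ 0] bexI[of _ "cc r * X ^ i * T ^ n"]) auto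
  next
    case True
    \<comment> \<open>The field \<open>(T + X E) d/dX + (b + X G) d/dT\<close> sends
      \<open>X ^ i * T ^ (n + 1)\<close> to \<open>(n + 1) b X ^ i * T ^ n\<close> up to higher
      order; hence the division by \<open>b\<close> and by \<open>n + 1\<close>.\<close>
    define r' where "r' = r * (1 / b) * (1 / of_nat (n + 1))"
    have r': "r' \<in> R"
      unfolding r'_def using mspan_monom b True by (intro csubring_mult[OF R] inv) auto
    have n1: "of_nat (n + 1) \<noteq> (0::complex)" by (simp only: of_nat_eq_0_iff)
    have rr: "r = r' * of_nat (n + 1) * b" unfolding r'_def using b n1 by (simp del: of_nat_add)
    define C where "C = cc r' * X ^ i * T ^ (n + 1)"
    \<comment> \<open>The two errors: \<open>u1\<close> comes from differentiating
      \<open>X ^ i\<close>, \<open>u2\<close> from the part \<open>X * G\<close> of the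
      \<open>T\<close>-component. Both have degree at least \<open>N + 1\<close>; for
      \<open>i = 0\<close> the truncated exponent \<open>i - 1\<close> meets the factor
      \<open>of_nat i = 0\<close>.\<close>
    define u1 where "u1 = of_nat i * X ^ (i - 1) * T ^ (n + 1) * (T + X * E)"
    define u2 where "u2 = of_nat (n + 1) * X ^ (i + 1) * T ^ n * G"
    have C: "C \<in> J (Suc N)" unfolding C_def using r' True by (intro mspan.mspan_monom) auto
    have u1: "u1 \<in> J (Suc N)"
    proof (cases i)
      case 0
      then show ?thesis by (simp add: u1_def J_0)
    next
      case (Suc k)
      have eq: "u1 = cc (of_nat i) * X ^ k * T ^ (n + 2) + (cc (of_nat i) * X ^ i * T ^ (n + 1)) * E"
        unfolding u1_def cc_of_nat by (simp add: Suc algebra_simps)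
      have "(cc (of_nat i) * X ^ i * T ^ (n + 1)) * E \<in> J (Suc N + 0)"
        using True by (intro J_mult E mspan.mspan_monom csubring_of_nat[OF R]) auto
      then show ?thesis
        unfolding eq using True Suc
        by (intro mspan_add mspan.mspan_monom csubring_of_nat[OF R]) auto
    qed
    have "(cc (of_nat (n + 1)) * X ^ (i + 1) * T ^ n) * G \<in> J (Suc N + 0)"
      using True by (intro J_mult G mspan.mspan_monom csubring_of_nat[OF R]) auto
    then have u2: "u2 \<in> J (Suc N)" unfolding u2_def cc_of_nat by simp
    have "cc r' * (u1 + u2) \<in> J (0 + Suc N)" by (intro J_mult J_cc r' mspan_add u1 u2)
    then have u': "- (cc r' * (u1 + u2)) \<in> J (Suc N)" by (intro J_uminus) simp
    have "(cc b + X * G) * vfield f C =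
        cc r' * (of_nat i * X ^ (i - 1) * T ^ (n + 1) * ((cc b + X * G) * vfield f X)
          + of_nat (n + 1) * X ^ i * T ^ n * (cc b + X * G) * vfield f T)"
      unfolding C_def mult.assoc vfield_cc_mult vfield_mult vfield_power
      by (simp add: algebra_simps)
    also have "\<dots> = cc r' * (u1 + u2 + of_nat (n + 1) * X ^ i * T ^ n * cc b) * vfield f T"
      unfolding conj u1_def u2_def by (simp add: algebra_simps)
    also have "\<dots> = (cc r * X ^ i * T ^ n - - (cc r' * (u1 + u2))) * vfield f T"
      unfolding rr cc_mult cc_of_nat by (simp add: algebra_simps)
    finally show ?thesis using C u' by blast
  qed
next
  case (mspan_add u v)
  then obtain C u' D v' where CD: "C \<in> J (Suc N)" "u' \<in> J (Suc N)" "D \<in> J (Suc N)" "v' \<in> J (Suc N)"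
    and eq: "(cc b + X * G) * vfield f C = (u - u') * vfield f T"
    "(cc b + X * G) * vfield f D = (v - v') * vfield f T" by blast
  have "(cc b + X * G) * vfield f (C + D) = (u + v - (u' + v')) * vfield f T"
    unfolding vfield_add distrib_left eq by (simp add: algebra_simps)
  then show ?case using mspan.mspan_add[OF CD(1,3)] mspan.mspan_add[OF CD(2,4)] by blast
qed

text \<open>The start is \<open>X\<close>, whose defect \<open>T + X * E\<close> has order 1. All
  corrections lie in \<open>J 2\<close>, so \<open>K\<close> keeps the linear term of
  \<open>X\<close>, and the number \<open>K $ 0 $ 1\<close> that has to be inverted later is a
  coefficient of the linear part of the conjugacy.\<close>

lemma approximate_first_integral:
  assumes "1 \<le> N" and inv: "\<And>m. 0 < m \<Longrightarrow> m \<le> N \<Longrightarrow> 1 / of_nat m \<in> R"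
  shows "\<exists>K. K - X \<in> J 2 \<and> (\<exists>u\<in>J N. (cc b + X * G) * vfield f K = u * vfield f T)"
  using assms
proof (induction N rule: nat_induct_at_least)
  case base
  have "X * E \<in> J (1 + 0)" by (intro J_mult J_X E)
  then have "T + X * E \<in> J 1" by (intro mspan_add J_T) simp
  then show ?case using conj J_0 by (intro exI[of _ X]) auto
next
  case (Suc N)
  then obtain K u where K: "K - X \<in> J 2" "u \<in> J N" "(cc b + X * G) * vfield f K = u * vfield f T"
    by (auto simp: le_Suc_eq)
  obtain C u' where C: "C \<in> J (Suc N)" "u' \<in> J (Suc N)"
    "(cc b + X * G) * vfield f C = (u - u') * vfield f T"
    using J_correction[OF K(2) Suc.prems] by blast
  have "(cc b + X * G) * vfield f (K - C) = u' * vfield f T"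
    using K(3) C(3) by (simp add: vfield_diff algebra_simps)
  moreover have "K - X - C \<in> J 2" using Suc.hyps by (intro J_diff[OF K(1) J_mono[OF C(1)]]) auto
  ultimately show ?case using C by (intro exI[of _ "K - C"]) (auto simp: algebra_simps)
qed

lemma J_ord_ge:
  assumes "ord_ge 1 X" "ord_ge 1 T" "u \<in> J N"
  shows "ord_ge N u"
  using assms(3)
proof induction
  case (mspan_monom r i n)
  have "ord_ge (0 + i + n) (cc r * X ^ i * T ^ n)"
    using assms by (intro ord_ge_mult ord_ge_power) auto
  then show ?case using mspan_monom by (auto intro: ord_ge_mono)
qed (auto intro: ord_ge_add)

text \<open>Restriction to the divisor \<open>x = 0\<close> is a ring homomorphism, so it only has
  to be controlled on \<open>X\<close> and \<open>T\<close>.\<close>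

lemma J_divisor_coeffs:
  assumes "\<And>n. X $ n $ 0 \<in> R" "\<And>n. T $ n $ 0 \<in> R" "u \<in> J N"
  shows "u $ n $ 0 \<in> R"
proof -
  have mult: "\<forall>n. (F * H) $ n $ 0 \<in> R" if "\<forall>n. F $ n $ 0 \<in> R" "\<forall>n. H $ n $ 0 \<in> R" for F H
    using that by (auto simp: fps2_mult_nth intro!: csubring_sum[OF R] csubring_mult[OF R])
  have c: "\<forall>n. cc r $ n $ 0 \<in> R" if "r \<in> R" for r
    using that csubring_0[OF R] by (simp add: cc_def)
  have pow: "\<forall>n. (F ^ k) $ n $ 0 \<in> R" if "\<forall>n. F $ n $ 0 \<in> R" for F k
  proof (induction k)
    case 0
    then show ?case using c[OF csubring_1[OF R]] by simp
  next
    case (Suc k)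
    then show ?case using mult[OF that] by simp
  qed
  have "\<forall>n. u $ n $ 0 \<in> R"
    using assms(3)
  proof induction
    case (mspan_monom r i n)
    then show ?case using assms by (intro mult pow c) auto
  qed (auto intro: csubring_add[OF R])
  then show ?thesis by blast
qed

lemma coeff_in_ring:
  assumes X: "ord_ge 1 X" "\<And>n. X $ n $ 0 = 0" "X $ 0 $ 1 \<noteq> 0" "1 / X $ 0 $ 1 \<in> R"
    and T: "ord_ge 1 T" "\<And>n. T $ n $ 0 \<in> R"
    and f: "f $ 0 = 0"
    and inv: "\<And>m. 0 < m \<Longrightarrow> m \<le> 2 * j + 1 \<Longrightarrow> 1 / of_nat m \<in> R"
  shows "f $ j \<in> R"
proof -
  \<comment> \<open>The order \<open>2 * j + 1\<close> is the weight at which \<open>f $ j\<close>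
    is reached.\<close>
  obtain K u where K: "K - X \<in> J 2" "u \<in> J (2 * j + 1)"
    "(cc b + X * G) * vfield f K = u * vfield f T"
    using approximate_first_integral[of "2 * j + 1"] inv by auto
  have "(cc b + X * G) $ 0 $ 0 = b" using X by (simp add: cc_def)
  \<comment> \<open>The inverse \<open>w\<close> of the unit may have coefficients outside
    \<open>R\<close>. It does no harm: only the vanishing order of \<open>vfield f K\<close> is read
    off.\<close>
  then obtain w where w: "(cc b + X * G) * w = 1" using b fps2_unit by metis
  have "vfield f K = (cc b + X * G) * w * vfield f K" unfolding w by simp
  also have "\<dots> = ((cc b + X * G) * vfield f K) * w" by (simp only: mult_ac)
  also have "\<dots> = u * (w * vfield f T)" unfolding K(3) by (simp only: mult_ac)
  finally have "ord_ge (2 * j + 1 + 0) (vfield f K)"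
    using ord_ge_mult[OF J_ord_ge[OF X(1) T(1) K(2)], of 0] by simp
  moreover have X0: "X $ n $ 0 \<in> R" for n using X csubring_0[OF R] by simp
  have "(K - X) + X \<in> J 1" using K by (intro mspan_add J_X J_mono[of "K - X" 2 1]) auto
  then have "K \<in> J 1" by simp
  then have "K $ n $ 0 \<in> R" for n by (rule J_divisor_coeffs[OF X0 T(2)])
  moreover have "(K - X) $ 0 $ 1 = 0" using J_ord_ge[OF X(1) T(1) K(1)] by (simp add: ord_ge_def)
  then have "K $ 0 $ 1 = X $ 0 $ 1" by simp
  ultimately show ?thesis
    using field_coeff_in_ring[OF R inv f, of "2 * j + 1" K "2 * j + 1"] X by simp
qed

end

section \<open>Convergent double power series\<close>

text \<open>As before the outer variable is the second one: \<open>F $ n $ m\<close> is the coefficient of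
  \<open>x\<^sup>m y\<^sup>n\<close>.\<close>

definition fps2 :: "(nat \<times> nat \<Rightarrow> complex) \<Rightarrow> complex fps fps" where
  "fps2 c = Abs_fps (\<lambda>n. Abs_fps (\<lambda>m. c (m, n)))"

lemma fps2_nth [simp]: "fps2 c $ n $ m = c (m, n)"
  by (simp add: fps2_def)

definition row :: "complex fps fps \<Rightarrow> complex \<Rightarrow> complex fps" where
  "row F x = Abs_fps (\<lambda>n. eval_fps (F $ n) x)"

lemma row_nth [simp]: "row F x $ n = eval_fps (F $ n) x"
  by (simp add: row_def)

definition ev2 :: "complex fps fps \<Rightarrow> complex \<Rightarrow> complex \<Rightarrow> complex" where
  "ev2 F x y = eval_fps (row F x) y"

text \<open>Convergence is required in iterated form: each coefficient series in \<open>x\<close>,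
  then the resulting series in \<open>y\<close>. Every operation reduces to one-variable power
  series, used once in each layer.\<close>

definition rep :: "real \<Rightarrow> complex fps fps \<Rightarrow> (complex \<Rightarrow> complex \<Rightarrow> complex) \<Rightarrow> bool" where
  "rep r F h \<longleftrightarrow> (\<forall>n. ereal r \<le> fps_conv_radius (F $ n)) \<and>
     (\<forall>x. norm x < r \<longrightarrow> ereal r \<le> fps_conv_radius (row F x)) \<and>
     (\<forall>x y. norm x < r \<longrightarrow> norm y < r \<longrightarrow> ev2 F x y = h x y)"

lemma rep_ev2: "rep r F h \<Longrightarrow> rep r F (ev2 F)"
  by (simp add: rep_def)

lemma repD:
  assumes "rep r F h" "norm x < r"
  shows "ereal (norm x) < fps_conv_radius (F $ n)"
    and "norm y < r \<Longrightarrow> ereal (norm y) < fps_conv_radius (row F x)"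
    and "norm y < r \<Longrightarrow> ev2 F x y = h x y"
  using assms unfolding rep_def
  by (auto intro: less_le_trans[of _ "ereal r"])

lemma rep_at_0: "0 < r \<Longrightarrow> rep r F h \<Longrightarrow> h 0 0 = F $ 0 $ 0"
  using repD(3)[of r F h 0 0] by (simp add: ev2_def eval_fps_at_0)

lemma sum_conv_radius:
  fixes f :: "'i \<Rightarrow> complex fps"
  assumes "finite I" "\<And>i. i \<in> I \<Longrightarrow> ereal r \<le> fps_conv_radius (f i)"
  shows "ereal r \<le> fps_conv_radius (sum f I) \<and>
    (\<forall>x. norm x < r \<longrightarrow> eval_fps (sum f I) x = (\<Sum>i\<in>I. eval_fps (f i) x))"
  using assms
proof (induction I rule: finite_induct)
  case (insert i I)
  then have *: "ereal r \<le> fps_conv_radius (f i)" "ereal r \<le> fps_conv_radius (sum f I)" by auto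
  then have "ereal r \<le> fps_conv_radius (f i + sum f I)"
    using order_trans[OF _ fps_conv_radius_add[of "f i" "sum f I"]] by simp
  moreover have "eval_fps (f i + sum f I) x = eval_fps (f i) x + eval_fps (sum f I) x" if "norm x < r" for x
    using * that by (intro eval_fps_add) (auto intro: less_le_trans[of _ "ereal r"])
  ultimately show ?case using insert by simp
qed auto

lemma mult_conv_radius:
  fixes f g :: "complex fps"
  assumes "ereal r \<le> fps_conv_radius f" "ereal r \<le> fps_conv_radius g"
  shows "ereal r \<le> fps_conv_radius (f * g)"
  using assms order_trans[OF _ fps_conv_radius_mult[of f g]] by simp

lemma rep_add:
  assumes "rep r F h" "rep r G k"
  shows "rep r (F + G) (\<lambda>x y. h x y + k x y)"
proof -
  have row: "row (F + G) x = row F x + row G x" if "norm x < r" for x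
    using repD(1)[OF assms(1) that] repD(1)[OF assms(2) that]
    by (simp add: fps_eq_iff eval_fps_add)
  show ?thesis
    unfolding rep_def
  proof (intro conjI allI impI)
    show "ereal r \<le> fps_conv_radius ((F + G) $ n)" for n
      using assms order_trans[OF _ fps_conv_radius_add[of "F $ n" "G $ n"]] by (simp add: rep_def)
    show "ereal r \<le> fps_conv_radius (row (F + G) x)" if "norm x < r" for x
      using assms that order_trans[OF _ fps_conv_radius_add[of "row F x" "row G x"]]
      by (simp add: rep_def row)
    show "ev2 (F + G) x y = h x y + k x y" if "norm x < r" "norm y < r" for x y
      using repD(2,3)[OF assms(1) that] repD(2,3)[OF assms(2) that] row[OF that(1)]
      by (simp add: ev2_def eval_fps_add)
  qed
qed

lemma rep_mult:
  assumes "rep r F h" "rep r G k"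
  shows "rep r (F * G) (\<lambda>x y. h x y * k x y)"
proof -
  have pr: "ereal r \<le> fps_conv_radius (F $ i * G $ j)" for i j
    using assms by (intro mult_conv_radius) (auto simp: rep_def)
  have row: "row (F * G) x = row F x * row G x" if "norm x < r" for x
  proof (rule fps_ext)
    fix n
    have "row (F * G) x $ n = (\<Sum>i=0..n. eval_fps (F $ i * G $ (n - i)) x)"
      using sum_conv_radius[of "{0..n}" r "\<lambda>i. F $ i * G $ (n - i)"] pr that
      by (simp add: fps_mult_nth)
    also have "\<dots> = (row F x * row G x) $ n"
      unfolding fps_mult_nth
      by (intro sum.cong refl) (simp add: eval_fps_mult repD(1)[OF assms(1) that] repD(1)[OF assms(2) that])
    finally show "row (F * G) x $ n = (row F x * row G x) $ n" .
  qed
  show ?thesis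
    unfolding rep_def
  proof (intro conjI allI impI)
    show "ereal r \<le> fps_conv_radius ((F * G) $ n)" for n
      using sum_conv_radius[of "{0..n}" r "\<lambda>i. F $ i * G $ (n - i)"] pr by (simp add: fps_mult_nth)
    show "ereal r \<le> fps_conv_radius (row (F * G) x)" if "norm x < r" for x
      unfolding row[OF that] using assms that by (intro mult_conv_radius) (auto simp: rep_def)
    show "ev2 (F * G) x y = h x y * k x y" if "norm x < r" "norm y < r" for x y
      using repD(2,3)[OF assms(1) that] repD(2,3)[OF assms(2) that] row[OF that(1)]
      by (simp add: ev2_def eval_fps_mult)
  qed
qed

lemma rep_cc: "rep r (cc c) (\<lambda>x y. c)"
proof -
  have nth: "cc c $ n = fps_const (if n = 0 then c else 0)" for n by (simp add: cc_def)
  have "row (cc c) x = fps_const c" for x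
    unfolding row_def nth by (simp add: fps_eq_iff)
  then show ?thesis by (simp add: rep_def ev2_def nth)
qed

lemma rep_diff:
  assumes "rep r F h" "rep r G k"
  shows "rep r (F - G) (\<lambda>x y. h x y - k x y)"
  using rep_add[OF assms(1) rep_mult[OF rep_cc[of r "-1"] assms(2)]]
  by (simp add: cc_uminus)

lemma rep_power: "rep r F h \<Longrightarrow> rep r (F ^ n) (\<lambda>x y. h x y ^ n)"
  by (induction n) (use rep_cc[of r 1] in \<open>auto intro: rep_mult\<close>)

lemma rep_sum:
  "finite I \<Longrightarrow> (\<And>i. i \<in> I \<Longrightarrow> rep r (F i) (h i)) \<Longrightarrow>
    rep r (\<Sum>i\<in>I. F i) (\<lambda>x y. \<Sum>i\<in>I. h i x y)"
  by (induction I rule: finite_induct) (use rep_cc[of r 0] in \<open>auto intro: rep_add\<close>)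

lemma rep_deriv:
  assumes "rep r F h"
  shows "rep r (fps_deriv F) (ev2 (fps_deriv F))"
    and "norm x < r \<Longrightarrow> norm y < r \<Longrightarrow> (ev2 F x has_field_derivative ev2 (fps_deriv F) x y) (at y)"
proof -
  have nth: "fps_deriv F $ n = fps_const (of_nat (n + 1)) * F $ (n + 1)" for n
    by (simp only: fps_deriv_nth fps_of_nat)
  have row: "row (fps_deriv F) x = fps_deriv (row F x)" if "norm x < r" for x
  proof (rule fps_ext)
    fix n
    have "eval_fps (fps_deriv F $ n) x = eval_fps (fps_const (of_nat (n + 1))) x * eval_fps (F $ (n + 1)) x"
      unfolding nth using repD(1)[OF assms that]
      by (intro eval_fps_mult) (simp_all only: fps_conv_radius_const less_ereal.simps)
    then show "row (fps_deriv F) x $ n = fps_deriv (row F x) $ n"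
      by (simp only: row_nth fps_deriv_nth eval_fps_const)
  qed
  show "rep r (fps_deriv F) (ev2 (fps_deriv F))"
    unfolding rep_def
  proof (intro conjI allI impI)
    show "ereal r \<le> fps_conv_radius (fps_deriv F $ n)" for n
      unfolding nth using assms by (intro mult_conv_radius) (auto simp: rep_def)
    show "ereal r \<le> fps_conv_radius (row (fps_deriv F) x)" if "norm x < r" for x
      unfolding row[OF that] using assms that fps_conv_radius_deriv[of "row F x"]
      by (auto simp: rep_def intro: order_trans)
  qed simp
  show "(ev2 F x has_field_derivative ev2 (fps_deriv F) x y) (at y)" if "norm x < r" "norm y < r"
    using has_field_derivative_eval_fps[OF repD(2)[OF assms that]] row[OF that(1)]
    unfolding ev2_def[abs_def] by simp
qed

text \<open>The one-variable identity theorem is applied twice: in \<open>y\<close> for each small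
  fixed \<open>x\<close>, then in \<open>x\<close> to each coefficient.\<close>

lemma rep_eq_0:
  assumes "rep r F h" "0 < r" "0 < e"
    and "\<And>x y. norm x < e \<Longrightarrow> norm y < e \<Longrightarrow> ev2 F x y = 0"
  shows "F = 0"
proof (rule fps_ext)
  fix n
  have ev: "\<forall>\<^sub>F x in nhds (0::complex). norm x < min e r"
    using assms(2,3) by (intro eventually_nhds_in_open[of "ball 0 (min e r)", THEN eventually_mono]) auto
  have row: "row F x = 0" if "norm x < min e r" for x
  proof (rule eval_fps_eqD)
    show "fps_conv_radius (row F x) > 0"
      using assms(1,2) that by (auto simp: rep_def intro: less_le_trans[of _ "ereal r"])
    show "\<forall>\<^sub>F y in nhds 0. eval_fps (row F x) y = eval_fps 0 y"
      using ev by eventually_elim (use assms(4) that in \<open>simp add: ev2_def\<close>)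
  qed simp
  have "F $ n = 0"
  proof (rule eval_fps_eqD)
    show "fps_conv_radius (F $ n) > 0"
      using assms(1,2) by (auto simp: rep_def intro: less_le_trans[of _ "ereal r"])
    show "\<forall>\<^sub>F x in nhds 0. eval_fps (F $ n) x = eval_fps 0 x"
      using ev
    proof eventually_elim
      case (elim x)
      show ?case using row[OF elim] row_nth[of F x n] by simp
    qed
  qed simp
  then show "F $ n = 0 $ n" by simp
qed

text \<open>A Cauchy-type bound survives termwise differentiation on half the radius, and it still
  gives summability at every point of the open bidisc of radius \<open>r\<close>.\<close>

definition coeff_bd :: "real \<Rightarrow> (nat \<times> nat \<Rightarrow> complex) \<Rightarrow> bool" where
  "coeff_bd r c \<longleftrightarrow> (\<exists>C. \<forall>m n. norm (c (m, n)) * r ^ (m + n) \<le> C)"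

lemma conv_ps_imp_coeff_bd:
  assumes "conv_ps c"
  obtains r where "0 < r" "coeff_bd r c"
proof -
  obtain r where r: "0 < r" "(\<lambda>(m,n). norm (c (m,n)) * r ^ (m+n)) summable_on UNIV"
    using assms by (auto simp: conv_ps_def)
  have "norm (c (m, n)) * r ^ (m + n) \<le> infsum (\<lambda>(m,n). norm (c (m,n)) * r ^ (m+n)) UNIV" for m n
    using finite_sum_le_infsum[OF r(2), of "{(m, n)}"] r(1) by auto
  then show ?thesis using that r by (auto simp: coeff_bd_def)
qed

lemma coeff_bd_mono:
  assumes "coeff_bd r c" "0 \<le> s" "s \<le> r"
  shows "coeff_bd s c"
proof -
  obtain C where C: "\<And>m n. norm (c (m, n)) * r ^ (m + n) \<le> C" using assms by (auto simp: coeff_bd_def)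
  have "norm (c (m, n)) * s ^ (m + n) \<le> C" for m n
    using assms by (intro order_trans[OF mult_left_mono C] power_mono) auto
  then show ?thesis by (auto simp: coeff_bd_def)
qed

lemma summable_geometric2:
  fixes u v :: real
  assumes "0 \<le> u" "u < 1" "0 \<le> v" "v < 1"
  shows "(\<lambda>(m, n). u ^ m * v ^ n) summable_on (UNIV :: (nat \<times> nat) set)"
proof -
  have g: "((\<lambda>n. w ^ n) has_sum (1 / (1 - w))) UNIV" if "0 \<le> w" "w < 1" for w :: real
    using that by (intro sums_nonneg_imp_has_sum geometric_sums) auto
  have "(\<lambda>(m, n). u ^ m * v ^ n) summable_on (SIGMA m:(UNIV :: nat set). (UNIV :: nat set))"
  proof (rule summable_on_SigmaI)
    show "((\<lambda>n. case (m, n) of (m, n) \<Rightarrow> u ^ m * v ^ n) has_sum (u ^ m * (1 / (1 - v)))) UNIV" for m :: nat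
      using has_sum_cmult_right[OF g[of v], of "u ^ m"] assms by simp
    show "(\<lambda>m. u ^ m * (1 / (1 - v))) summable_on UNIV"
      using has_sum_cmult_left[OF g[of u], of "1 / (1 - v)"] assms unfolding summable_on_def by blast
  qed (use assms in auto)
  then show ?thesis by simp
qed

lemma coeff_bd_summable:
  assumes "coeff_bd r c" "norm x < r" "norm y < r"
  shows "(\<lambda>(m, n). c (m, n) * x ^ m * y ^ n) summable_on UNIV"
proof -
  have r: "0 < r" using assms(2) by (metis norm_ge_zero le_less_trans)
  obtain C where C: "\<And>m n. norm (c (m, n)) * r ^ (m + n) \<le> C" using assms by (auto simp: coeff_bd_def)
  have "(\<lambda>z. C * (case z of (m, n) \<Rightarrow> (norm x / r) ^ m * (norm y / r) ^ n)) summable_on (UNIV :: (nat \<times> nat) set)"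
    using assms r by (intro summable_on_cmult_right summable_geometric2) auto
  then have "(\<lambda>z. norm (case z of (m, n) \<Rightarrow> c (m, n) * x ^ m * y ^ n)) summable_on UNIV"
  proof (rule summable_on_comparison_test)
    fix z :: "nat \<times> nat"
    obtain m n where z: "z = (m, n)" by (cases z)
    have "norm (c (m, n) * x ^ m * y ^ n) =
        (norm (c (m, n)) * r ^ (m + n)) * ((norm x / r) ^ m * (norm y / r) ^ n)"
      using r by (simp add: norm_mult norm_power power_divide power_add)
    also have "\<dots> \<le> C * ((norm x / r) ^ m * (norm y / r) ^ n)"
      using r by (intro mult_right_mono C) auto
    finally show "norm (case z of (m, n) \<Rightarrow> c (m, n) * x ^ m * y ^ n)
      \<le> C * (case z of (m, n) \<Rightarrow> (norm x / r) ^ m * (norm y / r) ^ n)" by (simp add: z)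
  qed auto
  then show ?thesis by (rule abs_summable_summable)
qed

lemma rep_ps_eval:
  assumes bd: "coeff_bd r c" and r: "0 < r"
  shows "rep r (fps2 c) (\<lambda>x y. ps_eval c (x, y))"
proof -
  let ?F = "fps2 c"
  have sumh: "((\<lambda>(n, m). c (m, n) * x ^ m * y ^ n) has_sum ps_eval c (x, y)) (UNIV \<times> UNIV)"
    if "norm x < r" "norm y < r" for x y
  proof -
    have "((\<lambda>(m, n). c (m, n) * x ^ m * y ^ n) has_sum ps_eval c (x, y)) (UNIV \<times> UNIV)"
      using coeff_bd_summable[OF bd that] by (simp add: ps_eval_def)
    \<comment> \<open>The outer summation index has to be the power of \<open>y\<close>, as in
      \<open>fps2\<close>.\<close>
    then show ?thesis by (subst (asm) has_sum_swap) simp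
  qed
  have inner: "(\<lambda>m. c (m, n) * x ^ m * y ^ n) summable_on UNIV" if "norm x < r" "norm y < r" for x y n
  proof -
    have "(\<lambda>(n, m). c (m, n) * x ^ m * y ^ n) summable_on (UNIV \<times> UNIV)"
      using sumh[OF that] by (auto simp: summable_on_def)
    from summable_on_SigmaD1[OF this, of n] show ?thesis by simp
  qed
  have rad: "ereal r \<le> fps_conv_radius (?F $ n)" for n
    unfolding fps_conv_radius_def
  proof (rule conv_radius_geI_ex')
    fix s assume s: "0 < s" "ereal s < ereal r"
    have "(\<lambda>m. c (m, n) * of_real s ^ m * of_real s ^ n) summable_on UNIV"
      using s by (intro inner) auto
    then have "summable (\<lambda>m. c (m, n) * of_real s ^ m * of_real s ^ n)"
      by (rule summable_on_imp_summable)
    from summable_mult2[OF this, of "1 / of_real s ^ n"]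
    have "summable (\<lambda>m. c (m, n) * of_real s ^ m)" using s by simp
    then show "summable (\<lambda>m. ?F $ n $ m * complex_of_real s ^ m)" by simp
  qed
  have outer: "((\<lambda>n. row ?F x $ n * y ^ n) has_sum ps_eval c (x, y)) UNIV"
    if xy: "norm x < r" "norm y < r" for x y
  proof (rule has_sum_SigmaD[OF sumh[OF xy]])
    fix n
    obtain S where S: "((\<lambda>m. c (m, n) * x ^ m * y ^ n) has_sum S) UNIV"
      using inner[OF xy] by (auto simp: summable_on_def)
    have sums: "(\<lambda>m. ?F $ n $ m * x ^ m * y ^ n) sums (eval_fps (?F $ n) x * y ^ n)"
      using xy rad by (intro sums_mult2 sums_eval_fps) (auto intro: less_le_trans[of _ "ereal r"])
    have "S = eval_fps (?F $ n) x * y ^ n"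
      using sums_unique2[OF has_sum_imp_sums[OF S]] sums by simp
    then show "((\<lambda>m. case (n, m) of (n, m) \<Rightarrow> c (m, n) * x ^ m * y ^ n) has_sum (row ?F x $ n * y ^ n)) UNIV"
      using S by simp
  qed
  show ?thesis
    unfolding rep_def
  proof (intro conjI allI impI rad)
    show "ereal r \<le> fps_conv_radius (row ?F x)" if x: "norm x < r" for x
      unfolding fps_conv_radius_def
    proof (rule conv_radius_geI_ex')
      fix s assume "0 < s" "ereal s < ereal r"
      then have "norm (complex_of_real s) < r" by simp
      from sums_summable[OF has_sum_imp_sums[OF outer[OF x this]]]
      show "summable (\<lambda>n. row ?F x $ n * of_real s ^ n)" .
    qed
    show "ev2 ?F x y = ps_eval c (x, y)" if "norm x < r" "norm y < r" for x y
      unfolding ev2_def eval_fps_def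
      using has_sum_imp_sums[OF outer[OF that]] by (simp add: sums_iff)
  qed
qed

lemma ps_eval_swap: "ps_eval c (x, y) = ps_eval (\<lambda>(m, n). c (n, m)) (y, x)"
  unfolding ps_eval_def
  by (rule infsum_reindex_bij_witness[of _ prod.swap prod.swap]) (auto simp: mult_ac)

text \<open>Exchanging the variables reduces the inner derivative to the outer one, treated in
  \<open>rep_deriv\<close>. The radius is halved so that \<open>2 ^ (m + n)\<close> absorbs the
  factor \<open>m + 1\<close> produced by differentiation.\<close>

lemma rep_inner_deriv:
  assumes bd: "coeff_bd r c" and r: "0 < r"
  shows "rep (r / 2) (inner_deriv (fps2 c)) (ev2 (inner_deriv (fps2 c)))"
    and "norm x < r / 2 \<Longrightarrow> norm y < r / 2 \<Longrightarrow>
      ((\<lambda>x. ps_eval c (x, y)) has_field_derivative ev2 (inner_deriv (fps2 c)) x y) (at x)"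
proof -
  define c' where "c' = (\<lambda>(m, n). of_nat (m + 1) * c (m + 1, n))"
  obtain C where C: "\<And>m n. norm (c (m, n)) * r ^ (m + n) \<le> C" using bd by (auto simp: coeff_bd_def)
  have C0: "0 \<le> C" using order_trans[OF norm_ge_zero[of "c (0, 0)"]] C[of 0 0] by simp
  have "norm (c' (m, n)) * (r / 2) ^ (m + n) \<le> C / r" for m n
  proof -
    have "of_nat (m + 1) \<le> (2::real) ^ (m + n)"
    proof -
      have "m + 1 \<le> 2 ^ m" using less_exp[of m] by (simp add: Suc_le_eq)
      also have "\<dots> \<le> (2::nat) ^ (m + n)" by (intro power_increasing) auto
      finally show ?thesis by (metis of_nat_le_iff of_nat_numeral of_nat_power)
    qed
    moreover have "norm (c' (m, n)) * (r / 2) ^ (m + n) =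
        (of_nat (m + 1) / 2 ^ (m + n)) * ((norm (c (m + 1, n)) * r ^ (m + 1 + n)) / r)"
      using r by (simp add: c'_def norm_mult power_divide del: of_nat_add of_nat_Suc)
    moreover have "\<dots> \<le> 1 * (C / r)"
      using calculation r C0 by (intro mult_mono divide_right_mono C) (auto simp: divide_le_eq)
    ultimately show ?thesis by simp
  qed
  then have bd': "coeff_bd (r / 2) c'" by (auto simp: coeff_bd_def)
  have D: "inner_deriv (fps2 c) = fps2 c'"
    by (simp add: fps_eq_iff inner_deriv_nth c'_def)
  show "rep (r / 2) (inner_deriv (fps2 c)) (ev2 (inner_deriv (fps2 c)))"
    unfolding D using rep_ps_eval[OF bd'] r by (auto intro: rep_ev2)
  let ?sw = "\<lambda>c (m, n). c (n, m)"
  have sw: "coeff_bd s (?sw d)" if "coeff_bd s d" for s d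
  proof -
    obtain C where C: "\<And>m n. norm (d (m, n)) * s ^ (m + n) \<le> C"
      using \<open>coeff_bd s d\<close> by (auto simp: coeff_bd_def)
    have "norm (d (n, m)) * s ^ (m + n) \<le> C" for m n using C[of n m] by (simp add: add.commute)
    then show ?thesis unfolding coeff_bd_def by auto
  qed
  have D': "fps_deriv (fps2 (?sw c)) = fps2 (?sw c')"
  proof (intro fps_ext)
    fix n m
    have "fps_deriv (fps2 (?sw c)) $ n = fps_const (of_nat (n + 1)) * fps2 (?sw c) $ (n + 1)"
      by (simp only: fps_deriv_nth fps_of_nat)
    then show "fps_deriv (fps2 (?sw c)) $ n $ m = fps2 (?sw c') $ n $ m"
      by (simp add: c'_def del: fps_deriv_nth)
  qed
  assume xy: "norm x < r / 2" "norm y < r / 2"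
  then have xy': "norm x < r" "norm y < r" using r by auto
  have r2: "rep r (fps2 (?sw c)) (\<lambda>x y. ps_eval (?sw c) (x, y))"
    by (rule rep_ps_eval[OF sw[OF bd] r])
  have "(ev2 (fps2 (?sw c)) y has_field_derivative ev2 (fps2 (?sw c')) y x) (at x)"
    using rep_deriv(2)[OF r2 xy'(2,1)] unfolding D' .
  moreover have "ev2 (fps2 (?sw c')) y x = ev2 (fps2 c') x y"
    using repD(3)[OF rep_ps_eval[OF sw[OF bd']] xy(2,1)] repD(3)[OF rep_ps_eval[OF bd'] xy] r
      ps_eval_swap[of c' x y] by simp
  moreover have "\<forall>\<^sub>F z in nhds x. ev2 (fps2 (?sw c)) y z = ps_eval c (z, y)"
  proof -
    have "\<forall>\<^sub>F z in nhds x. z \<in> ball 0 r" using xy' by (intro eventually_nhds_in_open) auto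
    then show ?thesis
      by eventually_elim (use repD(3)[OF r2 xy'(2)] ps_eval_swap[of c _ y] in auto)
  qed
  ultimately show "((\<lambda>x. ps_eval c (x, y)) has_field_derivative ev2 (inner_deriv (fps2 c)) x y) (at x)"
    unfolding D by (subst (asm) DERIV_cong_ev[OF refl _ refl, of _ "\<lambda>z. ps_eval c (z, y)"]) auto
qed

text \<open>Without a constant term every monomial contributes a factor \<open>norm q\<close>.
  Applied to the inverse of the conjugacy, this linear bound takes the place of a
  derivative.\<close>

lemma ps_eval_Lipschitz_at_0:
  assumes "conv_ps c" "ps_eval c 0 = 0"
  shows "\<exists>M. \<forall>\<^sub>F q in nhds 0. norm (ps_eval c q) \<le> M * norm q"
proof -
  obtain r where r: "0 < r" and s: "(\<lambda>(m,n). norm (c (m,n)) * r ^ (m+n)) summable_on UNIV"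
    using assms by (auto simp: conv_ps_def)
  obtain r' where "0 < r'" "coeff_bd r' c" using conv_ps_imp_coeff_bd[OF assms(1)] by blast
  then have c0: "c (0, 0) = 0"
    using rep_at_0[OF _ rep_ps_eval, of r' c] assms(2) by (simp add: zero_prod_def)
  define S where "S = infsum (\<lambda>(m,n). norm (c (m,n)) * r ^ (m+n)) UNIV"
  have "norm (ps_eval c q) \<le> S / r * norm q" if "norm q < r" for q
  proof -
    obtain x y where q: "q = (x, y)" by (cases q)
    define \<rho> where "\<rho> = norm q"
    have \<rho>: "norm x \<le> \<rho>" "norm y \<le> \<rho>" "0 \<le> \<rho>" "\<rho> < r"
      using that norm_fst_le[of x y] norm_snd_le[of y x] by (auto simp: \<rho>_def q)
    let ?g = "\<lambda>z. \<rho> / r * (case z of (m, n) \<Rightarrow> norm (c (m,n)) * r ^ (m+n))"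
    have le: "norm (case z of (m, n) \<Rightarrow> c (m, n) * x ^ m * y ^ n) \<le> ?g z" for z
    proof -
      obtain m n where z: "z = (m, n)" by (cases z)
      show ?thesis
      proof (cases "m + n")
        case 0
        then show ?thesis using c0 z by simp
      next
        case (Suc k)
        have "norm (c (m, n) * x ^ m * y ^ n) = norm (c (m, n)) * (norm x ^ m * norm y ^ n)"
          by (simp add: norm_mult norm_power)
        also have "\<dots> \<le> norm (c (m, n)) * (\<rho> ^ m * \<rho> ^ n)"
          using \<rho> by (intro mult_left_mono mult_mono power_mono) auto
        also have "\<rho> ^ m * \<rho> ^ n = \<rho> * \<rho> ^ k" by (simp add: power_add[symmetric] Suc)
        also have "norm (c (m, n)) * (\<rho> * \<rho> ^ k) \<le> norm (c (m, n)) * (\<rho> * r ^ k)"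
          using \<rho> by (intro mult_left_mono power_mono) auto
        also have "\<dots> = \<rho> / r * (norm (c (m, n)) * r ^ (m + n))" using r by (simp add: Suc)
        finally show ?thesis by (simp add: z)
      qed
    qed
    have sg: "?g summable_on UNIV" using s by (intro summable_on_cmult_right)
    have ab: "(\<lambda>z. norm (case z of (m, n) \<Rightarrow> c (m, n) * x ^ m * y ^ n)) summable_on UNIV"
      by (rule summable_on_comparison_test[OF sg]) (use le in auto)
    have "norm (ps_eval c q) \<le> infsum (\<lambda>z. norm (case z of (m, n) \<Rightarrow> c (m, n) * x ^ m * y ^ n)) UNIV"
      unfolding ps_eval_def q using norm_infsum_bound[OF ab] by simp
    also have "\<dots> \<le> infsum ?g UNIV" using ab sg le by (intro infsum_mono) auto
    also have "\<dots> = \<rho> / r * S" unfolding S_def using s by (intro infsum_cmult_right) auto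
    finally show ?thesis by (simp add: \<rho>_def mult.commute)
  qed
  moreover have "\<forall>\<^sub>F q in nhds 0. norm (q :: complex \<times> complex) < r"
    using eventually_nhds_in_open[of "ball 0 r" "0 :: complex \<times> complex"] r by simp
  ultimately show ?thesis by (intro exI[of _ "S / r"]) (auto elim: eventually_mono)
qed

section \<open>From the equivalence to formal power series\<close>

text \<open>The derivative \<open>l\<close> is a priori only real-linear. On each coordinate axis it
  agrees with multiplication by a complex partial derivative, and additivity does the rest.\<close>

lemma ps_eval_partials:
  assumes bd: "coeff_bd r c" and r: "0 < r" and xy: "norm x < r / 2" "norm y < r / 2"
    and l: "(ps_eval c has_derivative l) (at (x, y))"
  shows "l (u, v) = ev2 (inner_deriv (fps2 c)) x y * u + ev2 (fps_deriv (fps2 c)) x y * v"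
proof -
  have xy': "norm x < r" "norm y < r" using xy r by auto
  have rep: "rep r (fps2 c) (\<lambda>x y. ps_eval c (x, y))" by (rule rep_ps_eval[OF bd r])
  have "((\<lambda>z. ps_eval c (z, y)) has_derivative (\<lambda>h. l (h, 0))) (at x)"
    by (rule has_derivative_compose[where f = "\<lambda>z. (z, y)", OF _ l]) (auto intro!: derivative_eq_intros)
  moreover have "((\<lambda>z. ps_eval c (z, y)) has_derivative (*) (ev2 (inner_deriv (fps2 c)) x y)) (at x)"
    using rep_inner_deriv(2)[OF bd r xy] by (simp add: has_field_derivative_def)
  ultimately have 1: "(\<lambda>h. l (h, 0)) = (*) (ev2 (inner_deriv (fps2 c)) x y)"
    by (rule has_derivative_unique)
  have "((\<lambda>z. ps_eval c (x, z)) has_derivative (\<lambda>h. l (0, h))) (at y)"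
    by (rule has_derivative_compose[where f = "\<lambda>z. (x, z)", OF _ l]) (auto intro!: derivative_eq_intros)
  moreover have "((\<lambda>z. ps_eval c (x, z)) has_derivative (*) (ev2 (fps_deriv (fps2 c)) x y)) (at y)"
  proof -
    have "\<forall>\<^sub>F z in nhds y. z \<in> ball 0 r" using xy' by (intro eventually_nhds_in_open) auto
    then have "\<forall>\<^sub>F z in nhds y. ev2 (fps2 c) x z = ps_eval c (x, z)"
      by eventually_elim (use repD(3)[OF rep xy'(1)] in auto)
    from iffD1[OF DERIV_cong_ev[OF refl this refl] rep_deriv(2)[OF rep xy']]
    have "((\<lambda>z. ps_eval c (x, z)) has_field_derivative ev2 (fps_deriv (fps2 c)) x y) (at y)" .
    then show ?thesis by (simp add: has_field_derivative_def)
  qed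
  ultimately have 2: "(\<lambda>h. l (0, h)) = (*) (ev2 (fps_deriv (fps2 c)) x y)"
    by (rule has_derivative_unique)
  have "l ((u, 0) + (0, v)) = l (u, 0) + l (0, v)"
    by (rule linear_add[OF has_derivative_linear[OF l]])
  then show ?thesis using fun_cong[OF 1, of u] fun_cong[OF 2, of v] by simp
qed

definition phom :: "(nat \<times> nat \<Rightarrow> complex) \<Rightarrow> nat \<Rightarrow> complex fps fps \<Rightarrow> complex fps fps \<Rightarrow> complex fps fps" where
  "phom a j P Q = (\<Sum>m\<le>j. cc (a (m, j - m)) * P ^ m * Q ^ (j - m))"

definition peval :: "nat \<Rightarrow> (nat \<times> nat \<Rightarrow> complex) \<Rightarrow> complex fps fps \<Rightarrow> complex fps fps \<Rightarrow> complex fps fps" where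
  "peval d a P Q = (\<Sum>j\<le>d. phom a j P Q)"

lemma ps_eval_polynomial:
  assumes "\<And>m n. d < m + n \<Longrightarrow> a (m, n) = 0"
  shows "ps_eval a p = (\<Sum>j\<le>d. \<Sum>m\<le>j. a (m, j - m) * fst p ^ m * snd p ^ (j - m))"
proof -
  have fin: "finite {(m, n). m + n \<le> d}"
    by (rule finite_subset[of _ "{..d} \<times> {..d}"]) auto
  have "ps_eval a p = (\<Sum>\<^sub>\<infinity>(m,n)\<in>{(m, n). m + n \<le> d}. a (m, n) * fst p ^ m * snd p ^ n)"
    unfolding ps_eval_def by (rule infsum_cong_neutral) (use assms in auto)
  also have "\<dots> = (\<Sum>(m,n)\<in>{(m, n). m + n \<le> d}. a (m, n) * fst p ^ m * snd p ^ n)"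
    using fin by simp
  also have "\<dots> = (\<Sum>j\<le>d. \<Sum>m\<le>j. a (m, j - m) * fst p ^ m * snd p ^ (j - m))"
    by (rule sum.triangle_reindex_eq)
  finally show ?thesis .
qed

lemma rep_peval:
  assumes "\<And>m n. d < m + n \<Longrightarrow> a (m, n) = 0" "rep r P h" "rep r Q k"
  shows "rep r (peval d a P Q) (\<lambda>x y. ps_eval a (h x y, k x y))"
proof -
  have eq: "ps_eval a p = (\<Sum>j\<le>d. \<Sum>m\<le>j. a (m, j - m) * fst p ^ m * snd p ^ (j - m))" for p
    by (rule ps_eval_polynomial) (rule assms(1))
  show ?thesis
    unfolding eq peval_def phom_def fst_conv snd_conv
    by (intro rep_sum rep_mult rep_power rep_cc assms finite_atMost)
qed

text \<open>Along a kernel vector \<open>v\<close> the value \<open>\<Phi> (s *\<^sub>R v)\<close>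
  would be \<open>o(s)\<close>, whereas the Lipschitz inverse forces
  \<open>norm p \<le> M * norm (\<Phi> p)\<close> near the origin.\<close>

lemma biholo_germ_linear_part:
  assumes \<Phi>: "biholo_germ \<Phi>" and L: "(\<Phi> has_derivative L) (at 0)"
  shows "L v = 0 \<Longrightarrow> v = 0"
proof (rule ccontr)
  assume Lv: "L v = 0" and v: "v \<noteq> 0"
  have \<Phi>0: "\<Phi> 0 = 0" using \<Phi> by (simp add: biholo_germ_def)
  obtain \<Psi> c d where \<Psi>0: "\<Psi> 0 = 0" and c: "conv_ps c" "\<forall>\<^sub>F p in nhds 0. fst (\<Psi> p) = ps_eval c p"
    and d: "conv_ps d" "\<forall>\<^sub>F p in nhds 0. snd (\<Psi> p) = ps_eval d p"
    and inv: "\<forall>\<^sub>F p in nhds 0. \<Psi> (\<Phi> p) = p"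
    using \<Phi> unfolding biholo_germ_def holo_germ_def by (auto simp: eventually_conj_iff)
  have "ps_eval c 0 = 0" "ps_eval d 0 = 0"
    using eventually_nhds_x_imp_x[OF c(2)] eventually_nhds_x_imp_x[OF d(2)] \<Psi>0 by auto
  then obtain M1 M2 where M: "\<forall>\<^sub>F q in nhds 0. norm (ps_eval c q) \<le> M1 * norm q"
    "\<forall>\<^sub>F q in nhds 0. norm (ps_eval d q) \<le> M2 * norm q"
    using ps_eval_Lipschitz_at_0[OF c(1)] ps_eval_Lipschitz_at_0[OF d(1)] by blast
  \<comment> \<open>The maximum with 1 makes \<open>M\<close> positive, so that
    \<open>1 / (2 * M)\<close> can serve as the tolerance in the derivative.\<close>
  define M where "M = max 1 (M1 + M2)"
  have "\<forall>\<^sub>F q in nhds 0. norm (\<Psi> q) \<le> M * norm q"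
    using c(2) d(2) M
  proof eventually_elim
    case (elim q)
    have "norm (\<Psi> q) \<le> norm (fst (\<Psi> q)) + norm (snd (\<Psi> q))"
      using norm_Pair_le[of "fst (\<Psi> q)" "snd (\<Psi> q)"] by simp
    also have "\<dots> \<le> (M1 + M2) * norm q" using elim by (simp add: algebra_simps)
    also have "\<dots> \<le> M * norm q" by (intro mult_right_mono) (auto simp: M_def)
    finally show ?case .
  qed
  moreover have "filterlim \<Phi> (nhds 0) (nhds 0)"
    using has_derivative_continuous[OF L] \<Phi>0
    by (simp add: continuous_at tendsto_nhds_iff)
  ultimately have "\<forall>\<^sub>F p in nhds 0. norm (\<Psi> (\<Phi> p)) \<le> M * norm (\<Phi> p)"
    by (rule eventually_compose_filterlim)
  with inv have "\<forall>\<^sub>F p in nhds 0. norm p \<le> M * norm (\<Phi> p)"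
    by eventually_elim simp
  then obtain e where e: "0 < e" "\<And>p. norm p < e \<Longrightarrow> norm p \<le> M * norm (\<Phi> p)"
    unfolding eventually_nhds_metric by auto
  have M0: "0 < M" by (simp add: M_def)
  then obtain \<delta> where \<delta>: "0 < \<delta>" "\<And>p. norm p < \<delta> \<Longrightarrow> norm (\<Phi> p - L p) \<le> 1 / (2 * M) * norm p"
    using L \<Phi>0 unfolding has_derivative_at_alt by (auto dest!: spec[of _ "1 / (2 * M)"])
  define s where "s = min e \<delta> / (2 * norm v)"
  have s: "0 < s" using e \<delta> v by (simp add: s_def)
  have "norm (s *\<^sub>R v) = min e \<delta> / 2" using e \<delta> v by (simp add: s_def)
  then have n: "norm (s *\<^sub>R v) < e" "norm (s *\<^sub>R v) < \<delta>" "0 < norm (s *\<^sub>R v)" using e \<delta> by auto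
  have "L (s *\<^sub>R v) = 0" using linear_cmul[OF has_derivative_linear[OF L]] Lv by simp
  then have "norm (\<Phi> (s *\<^sub>R v)) \<le> 1 / (2 * M) * norm (s *\<^sub>R v)" using \<delta>(2)[OF n(2)] by simp
  then have "M * norm (\<Phi> (s *\<^sub>R v)) \<le> M * (1 / (2 * M) * norm (s *\<^sub>R v))"
    using M0 by (intro mult_left_mono) auto
  also have "\<dots> = norm (s *\<^sub>R v) / 2" using M0 by simp
  finally show False using e(2)[OF n(1)] n(3) by linarith
qed

text \<open>\<open>P\<close> and \<open>Q\<close> are the Taylor series of the components of the
  conjugacy. Since \<open>a'\<close> and \<open>b'\<close> are polynomials, composition with them is
  the finite expression \<open>peval\<close>, and the pointwise identity near 0 becomes the
  vanishing of a single convergent series \<open>Z\<close>.\<close>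

lemma hol_equiv_formal:
  assumes conv: "conv_ps a" "conv_ps b" and eqv: "hol_equiv a b a' b'"
    and a': "\<And>m n. d < m + n \<Longrightarrow> a' (m, n) = 0" and b': "\<And>m n. d < m + n \<Longrightarrow> b' (m, n) = 0"
  obtains P Q where "P $ 0 $ 0 = 0" "Q $ 0 $ 0 = 0" "P $ 0 $ 1 * Q $ 1 $ 0 \<noteq> P $ 1 $ 0 * Q $ 0 $ 1"
    "peval d b' P Q * (fps2 a * inner_deriv P + fps2 b * fps_deriv P) =
     peval d a' P Q * (fps2 a * inner_deriv Q + fps2 b * fps_deriv Q)"
proof -
  obtain \<Phi> where \<Phi>: "biholo_germ \<Phi>" and eq: "\<forall>\<^sub>F p in nhds 0. \<exists>L. (\<Phi> has_derivative L) (at p) \<and>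
        ps_eval b' (\<Phi> p) * fst (L (ps_eval a p, ps_eval b p))
        - ps_eval a' (\<Phi> p) * snd (L (ps_eval a p, ps_eval b p)) = 0"
    using eqv unfolding hol_equiv_def by blast
  obtain c1 c2 where c: "conv_ps c1" "conv_ps c2" and
    ev: "\<forall>\<^sub>F p in nhds 0. fst (\<Phi> p) = ps_eval c1 p" "\<forall>\<^sub>F p in nhds 0. snd (\<Phi> p) = ps_eval c2 p"
    and \<Phi>0: "\<Phi> 0 = 0"
    using \<Phi> unfolding biholo_germ_def holo_germ_def by blast
  define \<Phi>' where "\<Phi>' = (\<lambda>p. (ps_eval c1 p, ps_eval c2 p))"
  have ev': "\<forall>\<^sub>F p in nhds 0. \<Phi> p = \<Phi>' p"
    using ev by eventually_elim (simp add: \<Phi>'_def prod_eq_iff)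
  obtain ra where ra: "0 < ra" "coeff_bd ra a" using conv_ps_imp_coeff_bd[OF conv(1)] .
  obtain rb where rb: "0 < rb" "coeff_bd rb b" using conv_ps_imp_coeff_bd[OF conv(2)] .
  obtain r1 where r1: "0 < r1" "coeff_bd r1 c1" using conv_ps_imp_coeff_bd[OF c(1)] .
  obtain r2 where r2: "0 < r2" "coeff_bd r2 c2" using conv_ps_imp_coeff_bd[OF c(2)] .
  define r where "r = min (min ra rb) (min r1 r2)"
  have r: "0 < r" using ra rb r1 r2 by (simp add: r_def)
  have bd: "coeff_bd r a" "coeff_bd r b" "coeff_bd r c1" "coeff_bd r c2"
    using r coeff_bd_mono[OF ra(2), of r] coeff_bd_mono[OF rb(2), of r]
      coeff_bd_mono[OF r1(2), of r] coeff_bd_mono[OF r2(2), of r] by (simp_all add: r_def)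
  have r2: "0 < r / 2" using r by simp
  have bd2: "coeff_bd (r / 2) c" if "coeff_bd r c" for c using coeff_bd_mono[OF that, of "r / 2"] r by simp
  define P where "P = fps2 c1"
  define Q where "Q = fps2 c2"
  have repP: "rep (r / 2) P (\<lambda>x y. ps_eval c1 (x, y))" and repQ: "rep (r / 2) Q (\<lambda>x y. ps_eval c2 (x, y))"
    and repa: "rep (r / 2) (fps2 a) (\<lambda>x y. ps_eval a (x, y))"
    and repb: "rep (r / 2) (fps2 b) (\<lambda>x y. ps_eval b (x, y))"
    unfolding P_def Q_def using bd r2 by (auto intro!: rep_ps_eval bd2)
  have repPd: "rep (r / 2) (inner_deriv P) (ev2 (inner_deriv P))" "rep (r / 2) (fps_deriv P) (ev2 (fps_deriv P))"
    and repQd: "rep (r / 2) (inner_deriv Q) (ev2 (inner_deriv Q))" "rep (r / 2) (fps_deriv Q) (ev2 (fps_deriv Q))"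
    using rep_inner_deriv(1)[OF bd(3) r] rep_inner_deriv(1)[OF bd(4) r] rep_deriv(1)[OF repP] rep_deriv(1)[OF repQ]
    unfolding P_def Q_def by auto
  have L_eq: "L (u, v) = (ev2 (inner_deriv P) x y * u + ev2 (fps_deriv P) x y * v,
      ev2 (inner_deriv Q) x y * u + ev2 (fps_deriv Q) x y * v)"
    if L: "(\<Phi>' has_derivative L) (at (x, y))" and xy: "norm x < r / 2" "norm y < r / 2" for L x y u v
  proof -
    have "(ps_eval c1 has_derivative (\<lambda>z. fst (L z))) (at (x, y))"
      using has_derivative_fst[OF L] by (simp add: \<Phi>'_def)
    moreover have "(ps_eval c2 has_derivative (\<lambda>z. snd (L z))) (at (x, y))"
      using has_derivative_snd[OF L] by (simp add: \<Phi>'_def)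
    ultimately show ?thesis
      unfolding P_def Q_def using ps_eval_partials[OF bd(3) r xy] ps_eval_partials[OF bd(4) r xy]
      by (simp add: prod_eq_iff)
  qed
  define Z where "Z = peval d b' P Q * (fps2 a * inner_deriv P + fps2 b * fps_deriv P) -
     peval d a' P Q * (fps2 a * inner_deriv Q + fps2 b * fps_deriv Q)"
  have repZ: "rep (r / 2) Z (\<lambda>x y. ps_eval b' (ps_eval c1 (x, y), ps_eval c2 (x, y)) *
      (ps_eval a (x, y) * ev2 (inner_deriv P) x y + ps_eval b (x, y) * ev2 (fps_deriv P) x y) -
      ps_eval a' (ps_eval c1 (x, y), ps_eval c2 (x, y)) *
      (ps_eval a (x, y) * ev2 (inner_deriv Q) x y + ps_eval b (x, y) * ev2 (fps_deriv Q) x y))"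
    unfolding Z_def
    by (intro rep_diff rep_mult rep_add rep_peval repP repQ repa repb repPd repQd a' b')
  have "\<forall>\<^sub>F p in nhds 0. \<exists>L. (\<Phi>' has_derivative L) (at p) \<and>
        ps_eval b' (\<Phi>' p) * fst (L (ps_eval a p, ps_eval b p))
        - ps_eval a' (\<Phi>' p) * snd (L (ps_eval a p, ps_eval b p)) = 0"
    \<comment> \<open>To transfer derivatives at \<open>p\<close>, the two maps must agree in a
      neighbourhood of \<open>p\<close> and not only at \<open>p\<close>.\<close>
    using eq eventually_eventually[THEN iffD2, OF ev'] ev'
  proof eventually_elim
    case (elim p)
    then obtain L where L: "(\<Phi> has_derivative L) (at p)"
      "ps_eval b' (\<Phi> p) * fst (L (ps_eval a p, ps_eval b p))
        - ps_eval a' (\<Phi> p) * snd (L (ps_eval a p, ps_eval b p)) = 0" by blast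
    have "\<forall>\<^sub>F q in at p. \<Phi> q = \<Phi>' q" using elim(2) by (simp add: eventually_nhds_conv_at)
    then have "(\<Phi>' has_derivative L) (at p)"
      by (rule has_derivative_transform_eventually[OF L(1)]) (use elim in auto)
    then show ?case using L(2) elim(3) by auto
  qed
  then obtain e where e: "0 < e" and eqe: "\<And>p. norm p < e \<Longrightarrow> \<exists>L. (\<Phi>' has_derivative L) (at p) \<and>
        ps_eval b' (\<Phi>' p) * fst (L (ps_eval a p, ps_eval b p))
        - ps_eval a' (\<Phi>' p) * snd (L (ps_eval a p, ps_eval b p)) = 0"
    unfolding eventually_nhds_metric by auto
  have "Z = 0"
  proof (rule rep_eq_0[OF repZ r2, of "min (e / 2) (r / 2)"])
    fix x y :: complex assume xy: "norm x < min (e / 2) (r / 2)" "norm y < min (e / 2) (r / 2)"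
    then have xy2: "norm x < r / 2" "norm y < r / 2" by auto
    have "norm (x, y) < e" using norm_Pair_le[of x y] xy by auto
    from eqe[OF this] obtain L where L: "(\<Phi>' has_derivative L) (at (x, y))"
      "ps_eval b' (\<Phi>' (x, y)) * fst (L (ps_eval a (x, y), ps_eval b (x, y)))
        - ps_eval a' (\<Phi>' (x, y)) * snd (L (ps_eval a (x, y), ps_eval b (x, y))) = 0" by blast
    show "ev2 Z x y = 0"
      unfolding repD(3)[OF repZ xy2] using L(2) unfolding L_eq[OF L(1) xy2]
      by (simp add: \<Phi>'_def mult.commute)
  qed (use e r in auto)
  moreover have "\<Phi>' 0 = 0" using eventually_nhds_x_imp_x[OF ev'] \<Phi>0 by simp
  then have P0: "P $ 0 $ 0 = 0" and Q0: "Q $ 0 $ 0 = 0"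
    using rep_at_0[OF r2 repP] rep_at_0[OF r2 repQ] by (auto simp: \<Phi>'_def zero_prod_def)
  moreover have "P $ 0 $ 1 * Q $ 1 $ 0 \<noteq> P $ 1 $ 0 * Q $ 0 $ 1"
  proof
    assume det: "P $ 0 $ 1 * Q $ 1 $ 0 = P $ 1 $ 0 * Q $ 0 $ 1"
    obtain L where L: "(\<Phi> has_derivative L) (at 0)"
      using eventually_nhds_x_imp_x[OF eq] by blast
    have "\<forall>\<^sub>F q in at 0. \<Phi> q = \<Phi>' q" using ev' by (simp add: eventually_nhds_conv_at)
    then have "(\<Phi>' has_derivative L) (at (0, 0))"
      using has_derivative_transform_eventually[OF L] \<open>\<Phi>' 0 = 0\<close> \<Phi>0 by (simp add: zero_prod_def[symmetric])
    from L_eq[OF this] r2 have L': "L (u, v) = (P $ 0 $ 1 * u + P $ 1 $ 0 * v, Q $ 0 $ 1 * u + Q $ 1 $ 0 * v)" for u v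
      by (simp add: rep_at_0[OF r2 repPd(1)] rep_at_0[OF r2 repPd(2)] rep_at_0[OF r2 repQd(1)]
          rep_at_0[OF r2 repQd(2)] inner_deriv_nth)
    have inj: "u = 0 \<and> v = 0" if "P $ 0 $ 1 * u + P $ 1 $ 0 * v = 0" "Q $ 0 $ 1 * u + Q $ 1 $ 0 * v = 0" for u v
    proof -
      have "L (u, v) = 0" unfolding L' that by (simp add: zero_prod_def)
      from biholo_germ_linear_part[OF \<Phi> L this] show ?thesis by (simp add: zero_prod_def)
    qed
    \<comment> \<open>If the determinant vanishes, both \<open>(P $ 1 $ 0, - P $ 0 $ 1)\<close> and
      \<open>(Q $ 1 $ 0, - Q $ 0 $ 1)\<close> are in the kernel. By injectivity the matrix is zero,
      and then \<open>(1, 0)\<close> is in the kernel too.\<close>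
    have "P $ 1 $ 0 = 0 \<and> - P $ 0 $ 1 = 0" by (rule inj) (use det in \<open>auto simp: algebra_simps\<close>)
    moreover have "Q $ 1 $ 0 = 0 \<and> - Q $ 0 $ 1 = 0" by (rule inj) (use det in \<open>auto simp: algebra_simps\<close>)
    ultimately show False using inj[of 1 0] by simp
  qed
  ultimately show ?thesis by (intro that[of P Q]) (auto simp: Z_def)
qed

section \<open>The blow-up\<close>

text \<open>The blow-up substitution \<open>y = t x\<close>.\<close>

definition blow :: "complex fps fps \<Rightarrow> complex fps fps" where
  "blow F = Abs_fps (\<lambda>n. fps_X ^ n * F $ n)"

lemma blow_nth [simp]: "blow F $ n = fps_X ^ n * F $ n"
  by (simp add: blow_def)

lemma blow_add: "blow (F + G) = blow F + blow G"
  by (simp add: fps_eq_iff[of "blow (F + G)"] distrib_left)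

lemma blow_mult: "blow (F * G) = blow F * blow G"
proof (rule fps_ext)
  fix n
  have "fps_X ^ n * (F $ i * G $ (n - i)) = (fps_X ^ i * F $ i) * (fps_X ^ (n - i) * G $ (n - i))"
    if "i \<in> {0..n}" for i
  proof -
    have "(fps_X :: complex fps) ^ n = fps_X ^ i * fps_X ^ (n - i)"
      using that by (simp add: power_add[symmetric])
    then show ?thesis by (simp only: mult_ac)
  qed
  then show "blow (F * G) $ n = (blow F * blow G) $ n"
    unfolding blow_nth fps_mult_nth sum_distrib_left by (intro sum.cong refl)
qed

lemma blow_cc: "blow (cc c) = cc c"
proof (rule fps_ext)
  fix n show "blow (cc c) $ n = cc c $ n" by (cases n) (simp_all add: cc_def)
qed

lemma blow_power: "blow (F ^ n) = blow F ^ n"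
  using blow_cc[of 1] by (induction n) (simp_all add: blow_mult)

lemma blow_sum: "blow (\<Sum>i\<in>I. F i) = (\<Sum>i\<in>I. blow (F i))"
  using blow_cc[of 0] by (induction I rule: infinite_finite_induct) (simp_all add: blow_add)

lemma blow_peval: "blow (peval d a P Q) = peval d a (blow P) (blow Q)"
  by (simp add: peval_def phom_def blow_sum blow_mult blow_cc blow_power)

lemma fps_deriv_blow: "fps_deriv (blow F) = fps_const fps_X * blow (fps_deriv F)"
  by (rule fps_ext) (simp add: mult_ac)

lemma inner_deriv_blow: "inner_deriv (blow F) = blow (inner_deriv F) + fps_X * blow (fps_deriv F)"
proof (rule fps_ext)
  fix n
  show "inner_deriv (blow F) $ n = (blow (inner_deriv F) + fps_X * blow (fps_deriv F)) $ n"
  proof (cases n)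
    case (Suc k)
    have "fps_deriv ((fps_X :: complex fps) ^ Suc k) = of_nat (Suc k) * fps_X ^ k"
      by (simp only: fps_deriv_power fps_deriv_fps_X fps_of_nat diff_Suc_1 mult_1_right)
    then have "fps_deriv (fps_X ^ Suc k * F $ Suc k) =
        fps_X ^ Suc k * fps_deriv (F $ Suc k) + of_nat (Suc k) * fps_X ^ k * F $ Suc k"
      by (simp only: fps_deriv_mult)
    then show ?thesis
      by (simp add: Suc inner_deriv_nth fps_X_mult_nth mult_ac del: of_nat_Suc fps_deriv_mult power_Suc)
  qed (simp add: inner_deriv_nth)
qed

text \<open>By the chain rule \<open>F(x, t x)\<close> has \<open>x\<close>-derivative
  \<open>F_x + t F_y\<close> and \<open>t\<close>-derivative \<open>x F_y\<close>. As
  \<open>B = t A + x^3\<close>, the field becomes \<open>A d/dx + x^2 d/dt\<close>, and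
  \<open>A\<close> contains the factor \<open>x^2\<close> as well.\<close>

lemma blow_vfield:
  assumes A: "blow A = fps_const fps_X ^ 2 * (fps_X + fps_const f)"
    and B: "blow B = fps_X * blow A + fps_const fps_X ^ 3"
  shows "blow (A * inner_deriv F + B * fps_deriv F) = fps_const fps_X ^ 2 * vfield f (blow F)"
proof -
  define x :: "complex fps fps" where "x = fps_const fps_X"
  define g where "g = fps_const f"
  show ?thesis
    unfolding blow_add blow_mult B A vfield_def inner_deriv_blow fps_deriv_blow
      x_def[symmetric] g_def[symmetric]
    by (simp add: algebra_simps power2_eq_square power3_eq_cube)
qed

definition inner_shift :: "complex fps fps \<Rightarrow> complex fps fps" where
  "inner_shift F = Abs_fps (\<lambda>n. fps_shift 1 (F $ n))"

lemma blow_inner_shift: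
  assumes "P $ 0 $ 0 = 0"
  shows "blow P = fps_const fps_X * inner_shift (blow P)"
proof (rule fps_ext)
  fix n
  have "blow P $ n $ 0 = 0" using assms by (cases n) auto
  then show "blow P $ n = (fps_const fps_X * inner_shift (blow P)) $ n"
    by (simp add: inner_shift_def fps_eq_iff)
qed

text \<open>At \<open>x = 0\<close> the quotient \<open>P(x, t x) / x\<close> retains only the
  linear part of \<open>P\<close> at \<open>(1, t)\<close>; this is why the conjugacy acts on the
  divisor by a Moebius map.\<close>

lemma inner_shift_blow_divisor:
  "inner_shift (blow P) $ n $ 0 = (if n = 0 then P $ 0 $ 1 else if n = 1 then P $ 1 $ 0 else 0)"
proof (cases n)
  case (Suc k)
  then show ?thesis by (cases k) (simp_all add: inner_shift_def mult.assoc)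
qed (simp add: inner_shift_def)

lemma phom_scale: "phom a j (z * u) (z * v) = z ^ j * phom a j u v"
  unfolding phom_def sum_distrib_left
proof (rule sum.cong[OF refl])
  fix m assume "m \<in> {..j}"
  then have "z ^ j = z ^ m * z ^ (j - m)" by (simp add: power_add[symmetric])
  then show "cc (a (m, j - m)) * (z * u) ^ m * (z * v) ^ (j - m) =
      z ^ j * (cc (a (m, j - m)) * u ^ m * v ^ (j - m))"
    by (simp add: power_mult_distrib mult_ac)
qed

text \<open>The factor \<open>z\<close> is separate from \<open>u\<close> and \<open>v\<close>
  because two instances are needed: \<open>z = x\<close> with \<open>U\<close>, \<open>V\<close>,
  before \<open>U\<close> is known to be invertible, and \<open>z = X\<close> with \<open>1\<close>,
  \<open>T\<close> afterwards.\<close>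

lemma peval_scale:
  assumes "\<And>j. j < 2 \<Longrightarrow> phom a j u v = 0" and d: "4 \<le> d"
  shows "peval d a (z * u) (z * v) =
    z ^ 2 * (phom a 2 u v + z * (phom a 3 u v + z * (\<Sum>j=4..d. z ^ (j - 4) * phom a j u v)))"
proof -
  have "peval d a (z * u) (z * v) = (\<Sum>j\<in>{0, 1, 2, 3} \<union> {4..d}. z ^ j * phom a j u v)"
    unfolding peval_def phom_scale using d by (intro sum.cong) auto
  also have "\<dots> = (\<Sum>j\<in>{0, 1, 2, 3}. z ^ j * phom a j u v) + (\<Sum>j=4..d. z ^ j * phom a j u v)"
    by (rule sum.union_disjoint) auto
  also have "(\<Sum>j=4..d. z ^ j * phom a j u v) = z ^ 4 * (\<Sum>j=4..d. z ^ (j - 4) * phom a j u v)"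
    unfolding sum_distrib_left mult.assoc[symmetric] power_add[symmetric] by (intro sum.cong) auto
  also have "(\<Sum>j\<in>{0, 1, 2, 3}. z ^ j * phom a j u v) = z ^ 2 * phom a 2 u v + z ^ 3 * phom a 3 u v"
    using assms(1)[of 0] assms(1)[of 1] by (simp add: add.assoc)
  finally show ?thesis by (simp add: algebra_simps power2_eq_square power3_eq_cube power4_eq_xxxx)
qed

section \<open>Coefficients of the foliations in the class, and the explicit example\<close>

lemma hom_part_at_1: "hom_part c j (x, 1) = (\<Sum>m\<le>j. c (m, j - m) * x ^ m)"
  by (simp add: hom_part_def)

text \<open>Setting \<open>y = 1\<close> in the identities between homogeneous polynomial functions
  and comparing coefficients makes them available for formal series.\<close>

lemma in_T1_coeffs:
  assumes "in_T1 a b"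
  shows "j < 2 \<Longrightarrow> phom a j u v = 0" "j < 2 \<Longrightarrow> phom b j u v = 0"
    and "phom a 2 u v = u * v" "phom b 2 u v = v ^ 2"
    and "b (3, 0) \<noteq> 0" "phom b 3 1 v - v * phom a 3 1 v = cc (b (3, 0))"
proof -
  have low: "\<forall>j<2. hom_part a j = (\<lambda>_. 0) \<and> hom_part b j = (\<lambda>_. 0)"
    and a2: "hom_part a 2 = (\<lambda>p. fst p * snd p)" and b2: "hom_part b 2 = (\<lambda>p. snd p ^ 2)"
    using assms by (auto simp: in_T1_def)
  obtain \<beta> where \<beta>: "\<beta> \<noteq> 0" "\<And>x y. x * hom_part b 3 (x,y) - y * hom_part a 3 (x,y) = \<beta> * x ^ 4"
    using assms by (auto simp: in_T1_def)
  have "\<forall>m\<le>j. a (m, j - m) = 0 \<and> b (m, j - m) = 0" if "j < 2" for j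
  proof -
    have "\<forall>x. (\<Sum>m\<le>j. a (m, j - m) * x ^ m) = 0" "\<forall>x. (\<Sum>m\<le>j. b (m, j - m) * x ^ m) = 0"
      using low that by (simp_all add: hom_part_at_1[symmetric])
    then show ?thesis unfolding polyfun_eq_0 by blast
  qed
  then show "j < 2 \<Longrightarrow> phom a j u v = 0" "j < 2 \<Longrightarrow> phom b j u v = 0" by (simp_all add: phom_def)
  have "\<forall>x. (\<Sum>m\<le>2. a (m, 2 - m) * x ^ m) = (\<Sum>m\<le>2. (if m = 1 then 1 else 0) * x ^ m)"
    using a2 by (simp add: hom_part_at_1[symmetric]) (simp add: eval_nat_numeral)
  then have "\<forall>m\<le>2. a (m, 2 - m) = (if m = 1 then 1 else 0)" unfolding polyfun_eq_coeffs .
  then show "phom a 2 u v = u * v" by (simp add: phom_def numeral_2_eq_2)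
  have "\<forall>x. (\<Sum>m\<le>2. b (m, 2 - m) * x ^ m) = (\<Sum>m\<le>2. (if m = 0 then 1 else 0) * x ^ m)"
    using b2 by (simp add: hom_part_at_1[symmetric]) (simp add: eval_nat_numeral)
  then have "\<forall>m\<le>2. b (m, 2 - m) = (if m = 0 then 1 else 0)" unfolding polyfun_eq_coeffs .
  then show "phom b 2 u v = v ^ 2" by (simp add: phom_def numeral_2_eq_2)
  \<comment> \<open>\<open>e m\<close> is the coefficient of \<open>x ^ m\<close> in
    \<open>x b_3(x, 1) - a_3(x, 1) - \<beta> x ^ 4\<close>.\<close>
  define e where "e = (\<lambda>m::nat. if m = 0 then - a (0, 3) else if m = 1 then b (0, 3) - a (1, 2)
    else if m = 2 then b (1, 2) - a (2, 1) else if m = 3 then b (2, 1) - a (3, 0) else b (3, 0) - \<beta>)"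
  have "(\<Sum>m\<le>4. e m * x ^ m) = x * hom_part b 3 (x, 1) - hom_part a 3 (x, 1) - \<beta> * x ^ 4" for x
    by (simp add: hom_part_def e_def eval_nat_numeral algebra_simps)
  then have "\<forall>x. (\<Sum>m\<le>4. e m * x ^ m) = 0" using \<beta>(2)[of _ 1] by simp
  then have e0: "e m = 0" if "m \<le> 4" for m using that unfolding polyfun_eq_0 by blast
  have c: "a (0, 3) = 0" "b (0, 3) = a (1, 2)" "b (1, 2) = a (2, 1)" "b (2, 1) = a (3, 0)" "b (3, 0) = \<beta>"
    using e0[of 0] e0[of 1] e0[of 2] e0[of 3] e0[of 4] by (simp_all add: e_def)
  show "b (3, 0) \<noteq> 0" using c \<beta> by simp
  show "phom b 3 1 v - v * phom a 3 1 v = cc (b (3, 0))"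
    unfolding phom_def using c by (simp add: eval_nat_numeral algebra_simps)
qed

text \<open>The coefficients of \<open>x y + x\<^sup>2 f(x)\<close> and \<open>y\<^sup>2 + x y f(x) + x\<^sup>3\<close>, where
  \<open>f(x) = \<Sum>\<^sub>j \<phi>\<^sub>j x\<^sup>j\<close>.\<close>

definition field_x :: "(nat \<Rightarrow> complex) \<Rightarrow> nat \<times> nat \<Rightarrow> complex" where
  "field_x \<phi> = (\<lambda>(m, n). if (m, n) = (1, 1) then 1 else if n = 0 \<and> 3 \<le> m then \<phi> (m - 2) else 0)"

definition field_y :: "(nat \<Rightarrow> complex) \<Rightarrow> nat \<times> nat \<Rightarrow> complex" where
  "field_y \<phi> = (\<lambda>(m, n). if (m, n) = (0, 2) \<or> (m, n) = (3, 0) then 1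
     else if n = 1 \<and> 2 \<le> m then \<phi> (m - 1) else 0)"

lemma conv_ps_bounded:
  assumes "\<And>k. norm (c k) \<le> 1"
  shows "conv_ps c"
proof -
  have "(\<lambda>(m, n). norm (c (m, n)) * (1 / 2 :: real) ^ (m + n)) summable_on UNIV"
    by (rule summable_on_comparison_test[OF summable_geometric2[of "1 / 2" "1 / 2"]])
      (use assms in \<open>auto simp: power_add intro!: mult_left_le_one_le\<close>)
  then show ?thesis unfolding conv_ps_def by (intro exI[of _ "1 / 2"]) auto
qed

lemma in_T1_field:
  assumes "\<And>j. norm (\<phi> j) \<le> 1"
  shows "in_T1 (field_x \<phi>) (field_y \<phi>)"
  unfolding in_T1_def
proof (intro conjI allI impI exI[of _ 1])
  show "conv_ps (field_x \<phi>)" "conv_ps (field_y \<phi>)"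
    using assms by (auto intro!: conv_ps_bounded simp: field_x_def field_y_def)
  fix j :: nat assume "j < 2"
  then have "j = 0 \<or> j = 1" by auto
  then show "hom_part (field_x \<phi>) j = (\<lambda>_. 0)" "hom_part (field_y \<phi>) j = (\<lambda>_. 0)"
    by (auto simp: hom_part_def field_x_def field_y_def fun_eq_iff)
next
  show "hom_part (field_x \<phi>) 2 = (\<lambda>p. fst p * snd p)"
    by (simp add: hom_part_def field_x_def fun_eq_iff eval_nat_numeral)
  show "hom_part (field_y \<phi>) 2 = (\<lambda>p. snd p ^ 2)"
    by (simp add: hom_part_def field_y_def fun_eq_iff eval_nat_numeral)
  show "x * hom_part (field_y \<phi>) 3 (x, y) - y * hom_part (field_x \<phi>) 3 (x, y) = 1 * x ^ 4" for x y
    by (simp add: hom_part_def field_x_def field_y_def eval_nat_numeral algebra_simps)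
qed simp

lemma blow_field:
  assumes "\<phi> 0 = 0"
  shows "blow (fps2 (field_x \<phi>)) = fps_const fps_X ^ 2 * (fps_X + fps_const (Abs_fps \<phi>))" (is "?A = ?A'")
    and "blow (fps2 (field_y \<phi>)) = fps_X * blow (fps2 (field_x \<phi>)) + fps_const fps_X ^ 3" (is "?B = ?B'")
proof -
  have sq: "fps_const fps_X ^ 2 = (fps_const (fps_X ^ 2) :: complex fps fps)"
    and cube: "fps_const fps_X ^ 3 = (fps_const (fps_X ^ 3) :: complex fps fps)"
    by (simp_all add: fps_const_power)
  have x0: "fps2 (field_x \<phi>) $ 0 = fps_X ^ 2 * Abs_fps \<phi>"
  proof (rule fps_ext)
    fix n :: nat
    consider "n < 2" | "n = 2" | "3 \<le> n" by linarith
    then show "fps2 (field_x \<phi>) $ 0 $ n = (fps_X ^ 2 * Abs_fps \<phi>) $ n"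
      by cases (use assms in \<open>simp_all add: field_x_def fps_X_power_mult_nth\<close>)
  qed
  have x1: "fps2 (field_x \<phi>) $ 1 = fps_X"
    by (auto simp: fps_eq_iff field_x_def fps_X_def)
  have x2: "fps2 (field_x \<phi>) $ n = 0" if "2 \<le> n" for n
    using that by (auto simp: fps_eq_iff field_x_def)
  show A: "?A = ?A'"
  proof (rule fps_ext)
    fix n :: nat
    consider "n = 0" | "n = 1" | "2 \<le> n" by linarith
    then show "?A $ n = ?A' $ n"
      by cases (use x0 x1 x2 in \<open>simp_all add: sq distrib_left power2_eq_square\<close>)
  qed
  have y0: "fps2 (field_y \<phi>) $ 0 = fps_X ^ 3"
    by (auto simp: fps_eq_iff field_y_def fps_X_power_iff)
  have y1: "fps2 (field_y \<phi>) $ 1 = fps_X * Abs_fps \<phi>"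
  proof (rule fps_ext)
    fix n :: nat
    consider "n = 0" | "n = 1" | "2 \<le> n" by linarith
    then show "fps2 (field_y \<phi>) $ 1 $ n = (fps_X * Abs_fps \<phi>) $ n"
      by cases (use assms in \<open>simp_all add: field_y_def fps_X_mult_nth\<close>)
  qed
  have y2: "fps2 (field_y \<phi>) $ 2 = 1"
    by (auto simp: fps_eq_iff field_y_def)
  have y3: "fps2 (field_y \<phi>) $ n = 0" if "3 \<le> n" for n
    using that by (auto simp: fps_eq_iff field_y_def)
  show "?B = ?B'"
  proof (rule fps_ext)
    fix n :: nat
    consider "n = 0" | "n = 1" | "n = 2" | "3 \<le> n" by linarith
    then show "?B $ n = ?B' $ n"
      by cases (use y0 y1 y2 y3 x0 x1 x2 in
        \<open>simp_all add: cube power2_eq_square mult_ac\<close>)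
  qed
qed

section \<open>Non-algebraizable foliations\<close>

definition big_prime :: "nat \<Rightarrow> nat" where
  "big_prime j = (SOME p. prime p \<and> 2 * j + 1 < p)"

lemma big_prime: "prime (big_prime j)" "2 * j + 1 < big_prime j"
  using someI_ex[OF bigger_prime[of "2 * j + 1"]] by (auto simp: big_prime_def)

definition seed :: "nat \<Rightarrow> complex" where
  "seed j = (if j = 0 then 0 else 1 / of_nat (big_prime j))"

lemma norm_seed: "norm (seed j) \<le> 1"
  using big_prime(2)[of j] by (auto simp: seed_def norm_divide divide_le_eq)

lemma blown_up_equation:
  assumes \<phi>: "\<phi> 0 = 0"
    and eq: "peval d b' P Q * (fps2 (field_x \<phi>) * inner_deriv P + fps2 (field_y \<phi>) * fps_deriv P) =
     peval d a' P Q * (fps2 (field_x \<phi>) * inner_deriv Q + fps2 (field_y \<phi>) * fps_deriv Q)"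
  shows "peval d b' (blow P) (blow Q) * vfield (Abs_fps \<phi>) (blow P) =
    peval d a' (blow P) (blow Q) * vfield (Abs_fps \<phi>) (blow Q)"
proof -
  have "blow (peval d b' P Q) * (fps_const fps_X ^ 2 * vfield (Abs_fps \<phi>) (blow P)) =
      blow (peval d a' P Q) * (fps_const fps_X ^ 2 * vfield (Abs_fps \<phi>) (blow Q))"
    unfolding blow_vfield[OF blow_field[of \<phi>, OF \<phi>], symmetric] blow_mult[symmetric] eq ..
  then have "fps_const fps_X ^ 2 * (peval d b' (blow P) (blow Q) * vfield (Abs_fps \<phi>) (blow P)) =
      fps_const fps_X ^ 2 * (peval d a' (blow P) (blow Q) * vfield (Abs_fps \<phi>) (blow Q))"
    unfolding blow_peval by (simp only: mult_ac)
  moreover have "fps_const (fps_X :: complex fps) ^ 2 \<noteq> 0" by simp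
  ultimately show ?thesis using mult_left_cancel by blast
qed

lemma vfield_fps_const_X: "vfield f (fps_const fps_X) = fps_X + fps_const f"
proof -
  have "inner_deriv (fps_const fps_X) = 1"
  proof (rule fps_ext)
    fix n show "inner_deriv (fps_const fps_X) $ n = 1 $ n" by (cases n) (simp_all add: inner_deriv_nth)
  qed
  then show ?thesis by (simp add: vfield_def)
qed

text \<open>The tangency point \<open>t = 0\<close> of the one foliation goes to that of the other.\<close>

lemma tangency_preserved:
  assumes T1: "in_T1 a' b'" and d: "4 \<le> d" and f: "f $ 0 = 0"
    and eq: "peval d b' (fps_const fps_X * U) (fps_const fps_X * V) * vfield f (fps_const fps_X * U) =
      peval d a' (fps_const fps_X * U) (fps_const fps_X * V) * vfield f (fps_const fps_X * V)"
  shows "V $ 0 $ 0 * (V $ 0 $ 0 * U $ 1 $ 0 - U $ 0 $ 0 * V $ 1 $ 0) = 0"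
proof -
  define x :: "complex fps fps" where "x = fps_const fps_X"
  define g where "g = fps_X + fps_const f"
  define B3 where "B3 = phom b' 3 U V + x * (\<Sum>j=4..d. x ^ (j - 4) * phom b' j U V)"
  define A3 where "A3 = phom a' 3 U V + x * (\<Sum>j=4..d. x ^ (j - 4) * phom a' j U V)"
  have x0: "x \<noteq> 0" by (simp add: x_def)
  have vx: "vfield f (x * F) = g * F + x * vfield f F" for F
    by (simp add: x_def g_def vfield_mult vfield_fps_const_X)
  have b: "peval d b' (x * U) (x * V) = x ^ 2 * (V ^ 2 + x * B3)"
    unfolding B3_def using peval_scale[OF in_T1_coeffs(2)[OF T1] d] in_T1_coeffs(4)[OF T1] by simp
  have a: "peval d a' (x * U) (x * V) = x ^ 2 * (U * V + x * A3)"
    unfolding A3_def using peval_scale[OF in_T1_coeffs(1)[OF T1] d] in_T1_coeffs(3)[OF T1] by simp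
  have "x ^ 2 * (V ^ 2 + x * B3) * (g * U + x * vfield f U) = x ^ 2 * (U * V + x * A3) * (g * V + x * vfield f V)"
    using eq unfolding x_def[symmetric] b a vx .
  \<comment> \<open>The terms \<open>x ^ 2 * g * U * V ^ 2\<close> on the two sides cancel, and
    everything left is divisible by \<open>x ^ 3\<close>.\<close>
  then have "x ^ 3 * (V ^ 2 * vfield f U + B3 * (g * U + x * vfield f U)) =
      x ^ 3 * (U * V * vfield f V + A3 * (g * V + x * vfield f V))"
    by (simp add: algebra_simps power2_eq_square power3_eq_cube)
  then have "V ^ 2 * vfield f U + B3 * (g * U + x * vfield f U) =
      U * V * vfield f V + A3 * (g * V + x * vfield f V)" (is "?l = ?r")
    using x0 by simp
  then have "?l $ 0 $ 0 = ?r $ 0 $ 0" by simp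
  \<comment> \<open>At the origin \<open>x\<close> and \<open>g\<close> vanish, which removes
    \<open>A3\<close> and \<open>B3\<close>, the contributions of the cubic and higher
    terms.\<close>
  moreover have "g $ 0 $ 0 = 0" "x $ 0 $ 0 = 0" using f by (simp_all add: g_def x_def)
  moreover have "vfield f F $ 0 $ 0 = F $ 1 $ 0" for F using f by (simp add: vfield_def)
  ultimately show ?thesis by (simp add: power2_eq_square algebra_simps)
qed

text \<open>In \<open>b' - T a'\<close> at \<open>(X, X T)\<close> the quadratic parts cancel and
  the cubic part collapses to the constant \<open>b' (3, 0)\<close>, leaving
  \<open>X ^ 3 * (cc (b' (3, 0)) + X * G)\<close>. The product rule for \<open>X * T\<close> puts
  the same power \<open>X ^ 3\<close> on the other side.\<close>

lemma vfield_relation: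
  assumes T1: "in_T1 a' b'" and d: "4 \<le> d" and X0: "X \<noteq> 0"
    and eq: "peval d b' X (X * T) * vfield f X = peval d a' X (X * T) * vfield f (X * T)"
    and R: "csubring R" and coeffs: "\<And>k. a' k \<in> R" "\<And>k. b' k \<in> R"
  shows "\<exists>E\<in>mspan R X T 0. \<exists>G\<in>mspan R X T 0.
    (cc (b' (3, 0)) + X * G) * vfield f X = (T + X * E) * vfield f T"
proof -
  interpret mspan_ring R X T by unfold_locales (rule R)
  define B4 where "B4 = (\<Sum>j=4..d. X ^ (j - 4) * phom b' j 1 T)"
  define A4 where "A4 = (\<Sum>j=4..d. X ^ (j - 4) * phom a' j 1 T)"
  define E where "E = phom a' 3 1 T + X * A4"
  define G where "G = B4 - T * A4"
  have X: "X \<in> J 0" and T: "T \<in> J 0" using J_X J_T by (auto intro: J_mono)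
  have mult: "u * v \<in> J 0" if "u \<in> J 0" "v \<in> J 0" for u v using J_mult[OF that] by simp
  have ph: "phom c j 1 T \<in> J 0" if "\<And>k. c k \<in> R" for c j
    unfolding phom_def using that by (intro J_sum mult J_power T J_cc csubring_1[OF R]) (auto intro: J_cc[OF csubring_1[OF R], simplified])
  have "A4 \<in> J 0" "B4 \<in> J 0"
    unfolding A4_def B4_def using coeffs by (auto intro!: J_sum mult J_power X ph)
  then have EG: "E \<in> J 0" "G \<in> J 0"
    unfolding E_def G_def using coeffs by (auto intro!: mspan_add J_diff mult X T ph)
  have b: "peval d b' X (X * T) = X ^ 2 * (T ^ 2 + X * (phom b' 3 1 T + X * B4))"
    unfolding B4_def using peval_scale[OF in_T1_coeffs(2)[OF T1] d, where u = 1 and v = T and z = X] in_T1_coeffs(4)[OF T1] by simp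
  have a: "peval d a' X (X * T) = X ^ 2 * (T + X * E)"
    unfolding A4_def E_def using peval_scale[OF in_T1_coeffs(1)[OF T1] d, where u = 1 and v = T and z = X] in_T1_coeffs(3)[OF T1] by simp
  have "X ^ 3 * ((cc (b' (3, 0)) + X * G) * vfield f X) =
      (peval d b' X (X * T) - T * peval d a' X (X * T)) * vfield f X"
    unfolding a b in_T1_coeffs(6)[OF T1, of T, symmetric] E_def G_def
    by (simp add: algebra_simps power2_eq_square power3_eq_cube)
  also have "\<dots> = peval d a' X (X * T) * (X * vfield f T)"
    using eq by (simp add: vfield_mult algebra_simps)
  also have "\<dots> = X ^ 3 * ((T + X * E) * vfield f T)"
    unfolding a by (simp add: algebra_simps power2_eq_square power3_eq_cube)
  finally show ?thesis using X0 EG by auto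
qed

text \<open>\<open>R\<close> is chosen before \<open>j\<close>, and the conjugacy contributes only
  three generators to it, all from its linear part. The dependence on \<open>j\<close> is confined
  to the factorial inverted in \<open>loc\<close>.\<close>

lemma equivalent_coeffs_in_ring:
  assumes T1: "in_T1 a' b'" and fin: "finite {k. a' k \<noteq> 0}" "finite {k. b' k \<noteq> 0}"
    and \<phi>: "\<phi> 0 = 0" "\<And>j. norm (\<phi> j) \<le> 1"
    and eqv: "hol_equiv (field_x \<phi>) (field_y \<phi>) a' b'"
  shows "\<exists>R. csubring R \<and> few_primes R \<and> (\<forall>j. \<phi> j \<in> loc R (2 * j + 1))"
proof -
  have "finite ((\<lambda>(m, n). m + n) ` ({k. a' k \<noteq> 0} \<union> {k. b' k \<noteq> 0}))" using fin by simp
  then obtain d0 where d0: "\<forall>s\<in>(\<lambda>(m, n). m + n) ` ({k. a' k \<noteq> 0} \<union> {k. b' k \<noteq> 0}). s \<le> d0"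
    using finite_nat_set_iff_bounded_le by blast
  define d where "d = max 4 d0"
  have d: "4 \<le> d" by (simp add: d_def)
  have "m + n \<le> d0" if "a' (m, n) \<noteq> 0 \<or> b' (m, n) \<noteq> 0" for m n
    using d0 that by force
  then have supp: "a' (m, n) = 0" "b' (m, n) = 0" if "d < m + n" for m n
    using that by (fastforce simp: d_def)+
  have conv: "conv_ps (field_x \<phi>)" "conv_ps (field_y \<phi>)"
    using in_T1_field[of \<phi>, OF \<phi>(2)] by (simp_all add: in_T1_def)
  obtain P Q where P0: "P $ 0 $ 0 = 0" and Q0: "Q $ 0 $ 0 = 0"
    and det: "P $ 0 $ 1 * Q $ 1 $ 0 \<noteq> P $ 1 $ 0 * Q $ 0 $ 1"
    and eq: "peval d b' P Q * (fps2 (field_x \<phi>) * inner_deriv P + fps2 (field_y \<phi>) * fps_deriv P) =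
     peval d a' P Q * (fps2 (field_x \<phi>) * inner_deriv Q + fps2 (field_y \<phi>) * fps_deriv Q)"
    by (rule hol_equiv_formal[of "field_x \<phi>" "field_y \<phi>" a' b' d, OF conv eqv supp])
  define f where "f = Abs_fps \<phi>"
  have f0: "f $ 0 = 0" by (simp add: f_def \<phi>)
  define x :: "complex fps fps" where "x = fps_const fps_X"
  define U where "U = inner_shift (blow P)"
  define V where "V = inner_shift (blow Q)"
  have PU: "blow P = x * U" and QV: "blow Q = x * V"
    unfolding x_def U_def V_def by (rule blow_inner_shift[OF P0], rule blow_inner_shift[OF Q0])
  have U0: "U $ n $ 0 = (if n = 0 then P $ 0 $ 1 else if n = 1 then P $ 1 $ 0 else 0)"
    and V0: "V $ n $ 0 = (if n = 0 then Q $ 0 $ 1 else if n = 1 then Q $ 1 $ 0 else 0)" for n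
    unfolding U_def V_def by (rule inner_shift_blow_divisor)+
  have eq1: "peval d b' (x * U) (x * V) * vfield f (x * U) = peval d a' (x * U) (x * V) * vfield f (x * V)"
    using blown_up_equation[OF \<phi>(1) eq] unfolding PU QV f_def .
  from tangency_preserved[OF T1 d f0 eq1[unfolded x_def]]
  \<comment> \<open>The second factor is the determinant of the linear part up to sign, so the first
    one vanishes. Then \<open>P $ 0 $ 1 \<noteq> 0\<close>, \<open>U\<close> is a unit, and the
    quotient \<open>T = V / U\<close> is a power series.\<close>
  have Q10: "Q $ 0 $ 1 = 0" using det by (auto simp: U0 V0 algebra_simps)
  then have P10: "P $ 0 $ 1 \<noteq> 0" using det by auto
  obtain W where W: "U * W = 1" using fps2_unit[of U] P10 U0 by auto
  define T where "T = W * V"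
  define X where "X = x * U"
  have UT: "U * T = V" unfolding T_def mult.assoc[symmetric] W by simp
  have XT: "X * T = x * V" unfolding X_def mult.assoc UT ..
  have Xn: "X $ n = fps_X * U $ n" for n by (simp add: X_def x_def)
  have X00: "X $ n $ 0 = 0" for n by (simp add: Xn)
  have X01: "X $ 0 $ 1 = P $ 0 $ 1" using U0[of 0] by (simp add: Xn)
  have Xnz: "X \<noteq> 0" using X01 P10 by auto
  have eq2: "peval d b' X (X * T) * vfield f X = peval d a' X (X * T) * vfield f (X * T)"
    using eq1 unfolding X_def[symmetric] XT .
  define C where "C = a' ` {k. a' k \<noteq> 0} \<union> b' ` {k. b' k \<noteq> 0} \<union>
    {1 / b' (3, 0), P $ 1 $ 0, Q $ 1 $ 0, 1 / P $ 0 $ 1}"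
  have "finite C" using fin by (simp add: C_def)
  then obtain R where R: "csubring R" "few_primes R" "C \<subseteq> R" using finitely_generated_few_primes by blast
  have "\<phi> j \<in> loc R (2 * j + 1)" for j
  proof -
    let ?S = "loc R (2 * j + 1)"
    have S: "csubring ?S" by (rule csubring_loc[OF R(1)])
    have CS: "C \<subseteq> ?S" using R(3) loc_superset[OF R(1)] by blast
    have coeffs: "a' k \<in> ?S" "b' k \<in> ?S" for k
    proof -
      have "a' k = 0 \<or> a' k \<in> C" "b' k = 0 \<or> b' k \<in> C" unfolding C_def by blast+
      then show "a' k \<in> ?S" "b' k \<in> ?S" using CS csubring_0[OF S] by auto
    qed
    have gens: "1 / b' (3, 0) \<in> ?S" "P $ 1 $ 0 \<in> ?S" "Q $ 1 $ 0 \<in> ?S" "1 / P $ 0 $ 1 \<in> ?S"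
      using CS by (auto simp: C_def)
    obtain E G where EG: "E \<in> mspan ?S X T 0" "G \<in> mspan ?S X T 0"
      "(cc (b' (3, 0)) + X * G) * vfield f X = (T + X * E) * vfield f T"
      using vfield_relation[OF T1 d Xnz eq2 S coeffs] by blast
    have inverses: "1 / of_nat m \<in> ?S" if "0 < m" "m \<le> 2 * j + 1" for m
      by (rule loc_inverse[OF R(1) that])
    interpret formal_conjugacy ?S X T f E G "b' (3, 0)"
      by unfold_locales (use S in_T1_coeffs(5)[OF T1] gens EG in auto)
    \<comment> \<open>On the divisor \<open>U\<close> is affine in \<open>t\<close>, so division by
      it is a two-term recursion whose only denominator is \<open>P $ 0 $ 1\<close>.\<close>
    have T_rec: "(\<Sum>k\<le>n. U $ k $ 0 * T $ (n - k) $ 0) = V $ n $ 0" for n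
      using arg_cong[OF UT, of "\<lambda>F. F $ n $ 0"] unfolding fps2_mult_nth by simp
    have T0: "T $ 0 $ 0 = 0" using T_rec[of 0] P10 Q10 by (simp add: U0 V0)
    have TS: "T $ n $ 0 \<in> ?S" for n
    proof (induction n)
      case 0
      then show ?case using T0 csubring_0[OF S] by simp
    next
      case (Suc n)
      have "(\<Sum>k\<le>Suc n. U $ k $ 0 * T $ (Suc n - k) $ 0) =
          (\<Sum>k\<in>{0, 1}. U $ k $ 0 * T $ (Suc n - k) $ 0)"
        by (rule sum.mono_neutral_right) (auto simp: U0)
      then have "P $ 0 $ 1 * T $ Suc n $ 0 + P $ 1 $ 0 * T $ n $ 0 = V $ Suc n $ 0"
        using T_rec[of "Suc n"] by (simp add: U0)
      then have Teq: "T $ Suc n $ 0 = (1 / P $ 0 $ 1) * (V $ Suc n $ 0 - P $ 1 $ 0 * T $ n $ 0)"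
        using P10 by (simp add: field_simps)
      have "V $ Suc n $ 0 \<in> ?S" unfolding V0 using gens csubring_0[OF S] by auto
      then show ?case
        unfolding Teq by (intro csubring_mult[OF S gens(4)] csubring_diff[OF S] csubring_mult[OF S gens(2) Suc])
    qed
    have "f $ j \<in> ?S"
      by (rule coeff_in_ring)
        (use X00 X01 P10 gens TS T0 f0 inverses in \<open>auto simp: ord_ge_def\<close>)
    then show ?thesis by (simp add: f_def)
  qed
  then show ?thesis using R by blast
qed

theorem theorem1:
  shows "\<exists>a b. in_T1 a b \<and>
    \<not> (\<exists>a' b'. in_T1 a' b' \<and> finite {k. a' k \<noteq> 0} \<and> finite {k. b' k \<noteq> 0} \<and>
          hol_equiv a b a' b')"
proof (intro exI conjI notI)
  show "in_T1 (field_x seed) (field_y seed)" by (rule in_T1_field[OF norm_seed])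
  assume "\<exists>a' b'. in_T1 a' b' \<and> finite {k. a' k \<noteq> 0} \<and> finite {k. b' k \<noteq> 0} \<and>
          hol_equiv (field_x seed) (field_y seed) a' b'"
  then obtain a' b' where "in_T1 a' b'" "finite {k. a' k \<noteq> 0}" "finite {k. b' k \<noteq> 0}"
    "hol_equiv (field_x seed) (field_y seed) a' b'" by blast
  moreover have "seed 0 = 0" by (simp add: seed_def)
  ultimately obtain R where R: "csubring R" "few_primes R" "\<And>j. seed j \<in> loc R (2 * j + 1)"
    using equivalent_coeffs_in_ring[of a' b' seed] norm_seed by blast
  have mem: "1 / of_nat (big_prime j) \<in> R" if "j \<noteq> 0" for j
    using R(3)[of j] that by (intro loc_inverse_prime[OF R(1) big_prime]) (simp add: seed_def)
  \<comment> \<open>This is \<open>few_primes\<close> at the element 1: the primes invertible in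
    \<open>R\<close>.\<close>
  define S where "S = {p::nat. prime p \<and> (\<exists>k. \<exists>u\<in>R. (1::complex) ^ k = of_nat p * u)}"
  have "finite S" using R(2) csubring_1[OF R(1)] unfolding few_primes_def S_def by auto
  have "big_prime (Suc j) \<in> S" for j
  proof -
    have "(1::complex) ^ 0 = of_nat (big_prime (Suc j)) * (1 / of_nat (big_prime (Suc j)))"
      using big_prime(2)[of "Suc j"] by simp
    then show ?thesis using big_prime(1)[of "Suc j"] mem[of "Suc j"] unfolding S_def by blast
  qed
  then have "big_prime (Suc (Max S)) \<le> Max S" using \<open>finite S\<close> by (intro Max_ge)
  then show False using big_prime(2)[of "Suc (Max S)"] by simp
qed

end
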